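(* Let $\mathcal{M}_2$ be a general rotational surface of hyperbolic type in $\mathbb{E}^4_2$ with plane meridian curve $m$, i.e. the Lorentz surface $$z(u,v)=\left(f(u)\cosh\alpha v,\ g(u)\cosh\beta v,\ f(u)\sinh\alpha v,\ g(u)\sinh\beta v\right),\quad u\in J,\ v\in[0,2\pi),$$ where $\alpha,\beta$ are positive constants and $f,g$ are smooth functions on $J$ with $\alpha^2f^2+\beta^2g^2>0$ and $f'^2+g'^2>0$. Assume that $\mathcal{M}_2$ contains no open part of a plane. Then $\mathcal{M}_2$ has flat normal connection and non-parallel mean curvature vector field if and only if the meridian curve $m$ is determined by one of the following: (i) $f=c\,g$, where $c=const$, $c\neq0$, and $\alpha\neq\beta$; in this case $\mathcal{M}_2$ is a developable ruled surface in $\mathbb{E}^4_2$; (ii) $\dfrac{ff'+gg'}{\sqrt{f'^2+g'^2}\,\sqrt{\alpha^2f^2+\beta^2g^2}}=C$, where $C=const$, $C\neq0$.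
   Context: $\mathbb{E}^4_2$ is $\mathbb{R}^4$ with the metric $dx_1^2+dx_2^2-dx_3^2-dx_4^2$. $J\subset\mathbb{R}$ is an interval. The meridian curve $m$ is the plane curve $u\mapsto(f(u),g(u),0,0)$. A surface in $\mathbb{E}^4_2$ is Lorentz if its induced metric has signature $(1,1)$; here the first fundamental form is $E=f'^2+g'^2>0$, $F=0$, $G=-(\alpha^2f^2+\beta^2g^2)<0$. With $\sigma$ the second fundamental form and $D$ the normal connection, the mean curvature vector field is $H=\frac12\operatorname{tr}\sigma$; it is parallel if $DH=0$ identically, and non-parallel otherwise. The surface has flat normal connection if the curvature of the normal connection $\varkappa=\dfrac{\langle R^{\perp}(x,y)n_1,n_2\rangle}{\langle x,x\rangle\langle y,y\rangle-\langle x,y\rangle^2}$ vanishes identically, where $R^\perp$ is the curvature tensor of $D$, $x,y$ is a tangent frame and $n_1,n_2$ an orthonormal normal frame. A ruled surface (a surface swept out by straight lines) is developable if its normal space (equivalently, its tangent space) is constant along each fixed ruling. *)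

theory Defs
  imports "HOL-Analysis.Analysis"
begin

text \<open>
  All derivatives are taken within the parameter domain, so they are one-sided at boundary points
  that belong to it (in the theorem, for instance, at \<open>v = 0\<close>).
\<close>

definition smooth_on :: "real set \<Rightarrow> (real \<Rightarrow> 'a::real_normed_vector) \<Rightarrow> bool" where
  "smooth_on S h \<longleftrightarrow>
     (\<forall>n. ((\<lambda>k x. vector_derivative k (at x within S)) ^^ n) h differentiable_on S)"

definition Du :: "real set \<Rightarrow> (real \<Rightarrow> real \<Rightarrow> 'a::real_normed_vector) \<Rightarrow> real \<Rightarrow> real \<Rightarrow> 'a" where
  "Du J w u v = vector_derivative (\<lambda>s. w s v) (at u within J)"

definition Dv :: "real set \<Rightarrow> (real \<Rightarrow> real \<Rightarrow> 'a::real_normed_vector) \<Rightarrow> real \<Rightarrow> real \<Rightarrow> 'a" where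
  "Dv I w u v = vector_derivative (\<lambda>t. w u t) (at v within I)"

primrec Ck_on :: "nat \<Rightarrow> real set \<Rightarrow> real set \<Rightarrow> (real \<Rightarrow> real \<Rightarrow> 'a::real_normed_vector) \<Rightarrow> bool" where
  "Ck_on 0 J I w \<longleftrightarrow> continuous_on (J \<times> I) (\<lambda>(u, v). w u v)"
| "Ck_on (Suc k) J I w \<longleftrightarrow>
     (\<forall>u\<in>J. \<forall>v\<in>I. (\<lambda>s. w s v) differentiable (at u within J) \<and>
                    (\<lambda>t. w u t) differentiable (at v within I)) \<and>
     Ck_on k J I (Du J w) \<and> Ck_on k J I (Dv I w)"


section \<open>Parametrized surfaces in the pseudo-Euclidean space of index 2\<close>

definition ip42 :: "real^4 \<Rightarrow> real^4 \<Rightarrow> real" where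
  "ip42 x y = x$1 * y$1 + x$2 * y$2 - x$3 * y$3 - x$4 * y$4"

text \<open>
  A surface is given by a parametrization \<open>z\<close> on \<open>J \<times> I\<close>. The notions below are meant for
  surfaces whose induced metric is nondegenerate.
\<close>

type_synonym surf = "real \<Rightarrow> real \<Rightarrow> real^4"

definition fE :: "real set \<Rightarrow> real set \<Rightarrow> surf \<Rightarrow> real \<Rightarrow> real \<Rightarrow> real" where
  "fE J I z u v = ip42 (Du J z u v) (Du J z u v)"

definition fF :: "real set \<Rightarrow> real set \<Rightarrow> surf \<Rightarrow> real \<Rightarrow> real \<Rightarrow> real" where
  "fF J I z u v = ip42 (Du J z u v) (Dv I z u v)"

definition fG :: "real set \<Rightarrow> real set \<Rightarrow> surf \<Rightarrow> real \<Rightarrow> real \<Rightarrow> real" where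
  "fG J I z u v = ip42 (Dv I z u v) (Dv I z u v)"

definition tangent_space :: "real set \<Rightarrow> real set \<Rightarrow> surf \<Rightarrow> real \<Rightarrow> real \<Rightarrow> (real^4) set" where
  "tangent_space J I z u v = span {Du J z u v, Dv I z u v}"

definition normal_space :: "real set \<Rightarrow> real set \<Rightarrow> surf \<Rightarrow> real \<Rightarrow> real \<Rightarrow> (real^4) set" where
  "normal_space J I z u v = {n. \<forall>t\<in>tangent_space J I z u v. ip42 t n = 0}"

definition normal_part :: "real set \<Rightarrow> real set \<Rightarrow> surf \<Rightarrow> real \<Rightarrow> real \<Rightarrow> real^4 \<Rightarrow> real^4" where
  "normal_part J I z u v w =
     (THE n. n \<in> normal_space J I z u v \<and> w - n \<in> tangent_space J I z u v)"

text \<open>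
  The second fundamental form on the coordinate frame. The ambient connection is the flat one, so
  it is the normal part of the second partial derivatives.
\<close>

definition sff_uu :: "real set \<Rightarrow> real set \<Rightarrow> surf \<Rightarrow> surf" where
  "sff_uu J I z u v = normal_part J I z u v (Du J (Du J z) u v)"

definition sff_uv :: "real set \<Rightarrow> real set \<Rightarrow> surf \<Rightarrow> surf" where
  "sff_uv J I z u v = normal_part J I z u v (Du J (Dv I z) u v)"

definition sff_vv :: "real set \<Rightarrow> real set \<Rightarrow> surf \<Rightarrow> surf" where
  "sff_vv J I z u v = normal_part J I z u v (Dv I (Dv I z) u v)"

text \<open>
  Half the trace of the second fundamental form with respect to the induced metric, whose inverse
  matrix is \<open>(G, -F; -F, E) / (E G - F\<^sup>2)\<close>.
\<close>

definition mean_curvature_vector :: "real set \<Rightarrow> real set \<Rightarrow> surf \<Rightarrow> surf" where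
  "mean_curvature_vector J I z u v =
     (1/2) *\<^sub>R ((1 / (fE J I z u v * fG J I z u v - (fF J I z u v)\<^sup>2)) *\<^sub>R
       (fG J I z u v *\<^sub>R sff_uu J I z u v - (2 * fF J I z u v) *\<^sub>R sff_uv J I z u v
        + fE J I z u v *\<^sub>R sff_vv J I z u v))"

text \<open>The normal connection in the two coordinate directions, applied to a normal field \<open>n\<close>.\<close>

definition nconn_u :: "real set \<Rightarrow> real set \<Rightarrow> surf \<Rightarrow> surf \<Rightarrow> surf" where
  "nconn_u J I z n u v = normal_part J I z u v (Du J n u v)"

definition nconn_v :: "real set \<Rightarrow> real set \<Rightarrow> surf \<Rightarrow> surf \<Rightarrow> surf" where
  "nconn_v J I z n u v = normal_part J I z u v (Dv I n u v)"

definition parallel_normal_field :: "real set \<Rightarrow> real set \<Rightarrow> surf \<Rightarrow> surf \<Rightarrow> bool" where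
  "parallel_normal_field J I z n \<longleftrightarrow>
     (\<forall>u\<in>J. \<forall>v\<in>I. nconn_u J I z n u v = 0 \<and> nconn_v J I z n u v = 0)"

text \<open>
  The curvature tensor of the normal connection on the tangent frame \<open>x = z\<^sub>u\<close>, \<open>y = z\<^sub>v\<close>; there is
  no bracket term, because coordinate fields commute.
\<close>

definition normal_curv_tensor :: "real set \<Rightarrow> real set \<Rightarrow> surf \<Rightarrow> surf \<Rightarrow> surf" where
  "normal_curv_tensor J I z n u v =
     nconn_u J I z (nconn_v J I z n) u v - nconn_v J I z (nconn_u J I z n) u v"

definition normal_curvature ::
    "real set \<Rightarrow> real set \<Rightarrow> surf \<Rightarrow> surf \<Rightarrow> surf \<Rightarrow> real \<Rightarrow> real \<Rightarrow> real" where
  "normal_curvature J I z n1 n2 u v =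
     ip42 (normal_curv_tensor J I z n1 u v) (n2 u v) /
       (fE J I z u v * fG J I z u v - (fF J I z u v)\<^sup>2)"

text \<open>
  Normal vectors of either causal character are allowed. The field regularity \<open>C\<^sup>2\<close> is what the
  curvature tensor needs.
\<close>

definition orthonormal_normal_frame ::
    "real set \<Rightarrow> real set \<Rightarrow> surf \<Rightarrow> surf \<Rightarrow> surf \<Rightarrow> bool" where
  "orthonormal_normal_frame J I z n1 n2 \<longleftrightarrow>
     Ck_on 2 J I n1 \<and> Ck_on 2 J I n2 \<and>
     (\<forall>u\<in>J. \<forall>v\<in>I. n1 u v \<in> normal_space J I z u v \<and> n2 u v \<in> normal_space J I z u v \<and>
        \<bar>ip42 (n1 u v) (n1 u v)\<bar> = 1 \<and> \<bar>ip42 (n2 u v) (n2 u v)\<bar> = 1 \<and>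
        ip42 (n1 u v) (n2 u v) = 0)"

text \<open>
  Changing the tangent frame or the orthonormal normal frame multiplies the normal curvature by a
  nonvanishing function, so its vanishing is independent of both choices. Over a rectangle
  \<open>J \<times> I\<close> the normal bundle is trivial, so the quantification over frames is not vacuous.
\<close>

definition flat_normal_connection :: "real set \<Rightarrow> real set \<Rightarrow> surf \<Rightarrow> bool" where
  "flat_normal_connection J I z \<longleftrightarrow>
     (\<forall>n1 n2. orthonormal_normal_frame J I z n1 n2 \<longrightarrow>
        (\<forall>u\<in>J. \<forall>v\<in>I. normal_curvature J I z n1 n2 u v = 0))"

definition contains_open_part_of_plane :: "real set \<Rightarrow> real set \<Rightarrow> surf \<Rightarrow> bool" where
  "contains_open_part_of_plane J I z \<longleftrightarrow>
     (\<exists>W P. openin (top_of_set (J \<times> I)) W \<and> W \<noteq> {} \<and> affine P \<and> aff_dim P = 2 \<and>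
            (\<lambda>(u, v). z u v) ` W \<subseteq> P)"

text \<open>
  After the smooth change of parameters \<open>(u, v) \<mapsto> (s, t)\<close> the surface is \<open>\<gamma>(t) + s e(t)\<close>;
  the rulings are the curves \<open>t = const\<close>, which lie on the straight lines through \<open>\<gamma>(t)\<close> with
  direction \<open>e(t)\<close>.
\<close>

definition ruling_parameters ::
    "real set \<Rightarrow> real set \<Rightarrow> surf \<Rightarrow> (real \<Rightarrow> real \<Rightarrow> real) \<Rightarrow> (real \<Rightarrow> real \<Rightarrow> real) \<Rightarrow> bool" where
  "ruling_parameters J I z s t \<longleftrightarrow>
     (\<forall>k. Ck_on k J I s \<and> Ck_on k J I t) \<and>
     inj_on (\<lambda>(u, v). (s u v, t u v)) (J \<times> I) \<and>
     (\<forall>u\<in>J. \<forall>v\<in>I. Du J s u v * Dv I t u v - Dv I s u v * Du J t u v \<noteq> 0) \<and>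
     (\<exists>T \<gamma> e. is_interval T \<and> smooth_on T \<gamma> \<and> smooth_on T e \<and> (\<forall>r\<in>T. e r \<noteq> 0) \<and>
        (\<forall>u\<in>J. \<forall>v\<in>I. t u v \<in> T \<and> z u v = \<gamma> (t u v) + s u v *\<^sub>R e (t u v)))"

definition developable_ruled_surface :: "real set \<Rightarrow> real set \<Rightarrow> surf \<Rightarrow> bool" where
  "developable_ruled_surface J I z \<longleftrightarrow>
     (\<exists>s t. ruling_parameters J I z s t \<and>
        (\<forall>u\<in>J. \<forall>v\<in>I. \<forall>u'\<in>J. \<forall>v'\<in>I. t u v = t u' v' \<longrightarrow>
           normal_space J I z u v = normal_space J I z u' v'))"


section \<open>General rotational surfaces of hyperbolic type\<close>

definition rot_surf_hyp :: "real \<Rightarrow> real \<Rightarrow> (real \<Rightarrow> real) \<Rightarrow> (real \<Rightarrow> real) \<Rightarrow> surf" where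
  "rot_surf_hyp \<alpha> \<beta> f g u v =
     vector [f u * cosh (\<alpha> * v), g u * cosh (\<beta> * v), f u * sinh (\<alpha> * v), g u * sinh (\<beta> * v)]"

definition deriv_in :: "real set \<Rightarrow> (real \<Rightarrow> real) \<Rightarrow> real \<Rightarrow> real" where
  "deriv_in J h u = vector_derivative h (at u within J)"

end

theory Submission
  imports Defs
begin

text \<open>
  In the orthonormal frame of \<open>\<real>\<^sup>4\<close> that moves along with the hyperbolic rotation, everything on the
  surface is a function of \<open>u\<close> alone. Let \<open>n1\<close> and \<open>n2\<close> be the unit normals with coordinates
  proportional to \<open>(g', -f', 0, 0)\<close> and \<open>(0, 0, \<beta> g, -\<alpha> f)\<close>. Both are parallel in the direction \<open>u\<close>,
  and in the direction \<open>v\<close> they are turned into each other at the rate \<open>\<kappa> = \<alpha> \<beta> \<phi>\<close>, where \<open>\<phi>\<close> is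
  the quotient of case (ii). Hence the curvature of the normal connection is \<open>\<kappa>'\<close> up to a nonzero
  factor, and the connection is flat if and only if \<open>\<phi>\<close> is a constant \<open>C\<close>
  (\<open>flat_iff_\<phi>_constant\<close>). For arbitrary \<open>C\<^sup>2\<close> normal frames this uses that mixed partial derivatives
  commute up to the boundary of the parameter rectangle (\<open>mixed_partials_eq\<close>).

  The mean curvature vector is \<open>H = \<eta> n1\<close>, with normal derivatives \<open>\<eta>' n1\<close> and \<open>\<eta> \<kappa> n2\<close>. For
  \<open>C = 0\<close> the meridian lies on a circle around the origin, and there \<open>H\<close> is a constant multiple of the
  position vector, so it is parallel (\<open>parallel_if_M_0\<close>). For \<open>C \<noteq> 0\<close> a parallel \<open>H\<close> vanishes. In that
  case the Ricci equation (\<open>\<phi>_deriv\<close>) says that either the mixed component or both other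
  components of the second fundamental form are zero; the latter alternative is excluded by
  \<open>minimal_flat_imp_W_0\<close>, and the former one makes the surface planar (\<open>plane_if_W_0_minimal\<close>). So
  flat and non-parallel means that \<open>\<phi>\<close> is a nonzero constant, which is (ii).

  Case (i) is a special case of (ii) (\<open>line_imp_\<phi>_constant\<close>): the meridian runs on a line through the
  origin. The surface is then a cone whose tangent plane is constant along each ray.
\<close>

section \<open>One-sided calculus on intervals\<close>

definition proper_interval :: "real set \<Rightarrow> bool" where
  "proper_interval S \<longleftrightarrow> is_interval S \<and> interior S \<noteq> {}"

lemma proper_interval_islimpt:
  assumes "proper_interval S" "x \<in> S"
  shows "x islimpt S"
proof (rule connected_imp_perfect)
  show "connected S"
    using assms by (simp add: proper_interval_def is_interval_connected_1)
  show "S \<noteq> {a}" for a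
    using assms unfolding proper_interval_def by auto
qed (use assms in auto)

lemma proper_interval_vector_derivative:
  assumes "proper_interval S" "x \<in> S" "(h has_vector_derivative h') (at x within S)"
  shows "vector_derivative h (at x within S) = h'"
  using assms proper_interval_islimpt[of S x]
  by (intro vector_derivative_within) (auto simp: trivial_limit_within)

lemma has_vector_derivative_eq_on:
  assumes "(h has_vector_derivative d) (at x within S)" "x \<in> S" "\<And>y. y \<in> S \<Longrightarrow> k y = h y"
  shows "(k has_vector_derivative d) (at x within S)"
  using has_vector_derivative_transform[of x S k h d] assms by auto

text \<open>
  The end points are in no particular order, because the second differences below are taken at
  corners that may lie on either side of the given point.
\<close>

lemma mvt_in_interval:
  fixes h :: "real \<Rightarrow> real"
  assumes "is_interval S" "a \<in> S" "b \<in> S"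
    and deriv: "\<And>x. x \<in> S \<Longrightarrow> (h has_vector_derivative h' x) (at x within S)"
  obtains \<xi> where "\<xi> \<in> S" "\<bar>\<xi> - a\<bar> \<le> \<bar>b - a\<bar>" "h b - h a = (b - a) * h' \<xi>"
proof -
  have ordered: "\<exists>\<xi>. \<xi> \<in> S \<and> x < \<xi> \<and> \<xi> < y \<and> h y - h x = (y - x) * h' \<xi>"
    if xy: "x < y" "x \<in> S" "y \<in> S" for x y
  proof -
    have sub: "{x..y} \<subseteq> S"
      using xy assms(1) unfolding is_interval_1 by (meson atLeastAtMost_iff subsetI)
    have "(h has_derivative (\<lambda>t. t *\<^sub>R h' z)) (at z within {x..y})" if "x \<le> z" "z \<le> y" for z
    proof -
      have "z \<in> S" using sub that by auto
      from has_vector_derivative_within_subset[OF deriv[OF this] sub] show ?thesis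
        by (simp only: has_vector_derivative_def)
    qed
    from mvt_simple[OF xy(1) this] obtain \<xi> where
      \<xi>: "\<xi> \<in> {x<..<y}" "h y - h x = (y - x) *\<^sub>R h' \<xi>"
      by blast
    then have "\<xi> \<in> S" using sub by auto
    with \<xi> show ?thesis by auto
  qed
  consider "a < b" | "a = b" | "b < a" by linarith
  then show ?thesis
  proof cases
    case 1
    then obtain \<xi> where "\<xi> \<in> S" "a < \<xi>" "\<xi> < b" "h b - h a = (b - a) * h' \<xi>"
      using ordered assms(2,3) by blast
    then show ?thesis by (intro that[of \<xi>]) simp_all
  next
    case 2
    then show ?thesis using assms(2) by (intro that[of a]) simp_all
  next
    case 3
    then obtain \<xi> where "\<xi> \<in> S" "b < \<xi>" "\<xi> < a" "h a - h b = (a - b) * h' \<xi>"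
      using ordered assms(2,3) by blast
    then show ?thesis by (intro that[of \<xi>]) (simp_all add: algebra_simps)
  qed
qed

text \<open>
  The derivatives are existentially quantified, rather than given by \<^const>\<open>vector_derivative\<close>:
  the closure properties below then need neither uniqueness of derivatives nor congruence on \<open>S\<close>.
\<close>

primrec Ck :: "nat \<Rightarrow> real set \<Rightarrow> (real \<Rightarrow> 'a::real_normed_vector) \<Rightarrow> bool" where
  "Ck 0 S h \<longleftrightarrow> continuous_on S h"
| "Ck (Suc k) S h \<longleftrightarrow>
     (\<exists>h'. (\<forall>x\<in>S. (h has_vector_derivative h' x) (at x within S)) \<and> Ck k S h')"

lemma Ck_SucI:
  "(\<And>x. x \<in> S \<Longrightarrow> (h has_vector_derivative h' x) (at x within S)) \<Longrightarrow> Ck k S h' \<Longrightarrow> Ck (Suc k) S h"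
  by auto

lemma Ck_cong:
  assumes "Ck k S l" "\<And>x. x \<in> S \<Longrightarrow> h x = l x"
  shows "Ck k S h"
proof (cases k)
  case 0
  then show ?thesis using assms by (simp cong: continuous_on_cong)
next
  case (Suc n)
  obtain l' where "\<forall>x\<in>S. (l has_vector_derivative l' x) (at x within S)" "Ck n S l'"
    using assms(1) Suc by auto
  moreover have "\<forall>x\<in>S. (h has_vector_derivative l' x) (at x within S)"
    using calculation(1) assms(2) has_vector_derivative_eq_on[of l _ _ S h] by blast
  ultimately show ?thesis using Suc by auto
qed

lemma Ck_SucD: "Ck (Suc k) S h \<Longrightarrow> Ck k S h"
proof (induction k arbitrary: h)
  case 0
  then show ?case
    by (auto simp: continuous_on_eq_continuous_within
        intro: has_vector_derivative_continuous)
next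
  case (Suc k)
  obtain h' where h': "\<forall>x\<in>S. (h has_vector_derivative h' x) (at x within S)" "Ck (Suc k) S h'"
    using Suc.prems Ck.simps(2)[of "Suc k" S h] by blast
  then show ?case using Suc.IH[of h'] Ck.simps(2)[of k S h] by blast
qed

lemma Ck_const: "Ck k S (\<lambda>_. c)"
  by (induction k arbitrary: c) (auto intro!: exI[of _ "\<lambda>_. 0"] derivative_eq_intros)

lemma Ck_ident: "Ck k S (\<lambda>x. x)"
  by (cases k) (auto intro!: exI[of _ "\<lambda>_. 1"] derivative_eq_intros Ck_const simp: continuous_on_id)

lemma Ck_add: "Ck k S h \<Longrightarrow> Ck k S l \<Longrightarrow> Ck k S (\<lambda>x. h x + l x)"
proof (induction k arbitrary: h l)
  case 0
  then show ?case by (auto intro: continuous_intros)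
next
  case (Suc k)
  obtain h' l' where
    "\<forall>x\<in>S. (h has_vector_derivative h' x) (at x within S)" "Ck k S h'"
    "\<forall>x\<in>S. (l has_vector_derivative l' x) (at x within S)" "Ck k S l'"
    using Suc.prems by auto
  then show ?case using Suc.IH[of h' l']
    by (auto intro!: exI[of _ "\<lambda>x. h' x + l' x"] has_vector_derivative_add)
qed

lemma Ck_scaleR:
  fixes p :: "real \<Rightarrow> real"
  shows "Ck k S p \<Longrightarrow> Ck k S h \<Longrightarrow> Ck k S (\<lambda>x. p x *\<^sub>R h x)"
proof (induction k arbitrary: p h)
  case 0
  then show ?case by (auto intro: continuous_intros)
next
  case (Suc k)
  obtain p' h' where d:
    "\<forall>x\<in>S. (p has_vector_derivative p' x) (at x within S)" "Ck k S p'"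
    "\<forall>x\<in>S. (h has_vector_derivative h' x) (at x within S)" "Ck k S h'"
    using Suc.prems by auto
  have "Ck k S (\<lambda>x. p x *\<^sub>R h' x + p' x *\<^sub>R h x)"
    using d Suc.IH Suc.prems[THEN Ck_SucD] by (intro Ck_add) auto
  moreover have "((\<lambda>x. p x *\<^sub>R h x) has_vector_derivative p x *\<^sub>R h' x + p' x *\<^sub>R h x) (at x within S)"
    if "x \<in> S" for x
    using d that
    by (intro has_vector_derivative_scaleR)
       (auto simp: has_real_derivative_iff_has_vector_derivative)
  ultimately show ?case by (rule Ck_SucI[rotated])
qed

lemma Ck_mult:
  fixes p q :: "real \<Rightarrow> real"
  shows "Ck k S p \<Longrightarrow> Ck k S q \<Longrightarrow> Ck k S (\<lambda>x. p x * q x)"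
  using Ck_scaleR[of k S p q] by simp

text \<open>
  The function \<open>r = h powr (- 1/2)\<close> solves \<open>r' = - h' r\<^sup>3 / 2\<close>, so each degree of smoothness
  of \<open>r\<close> yields the next one.
\<close>

lemma Ck_inverse_sqrt:
  fixes h :: "real \<Rightarrow> real"
  assumes "Ck k S h" "\<And>x. x \<in> S \<Longrightarrow> h x > 0"
  shows "Ck k S (\<lambda>x. 1 / sqrt (h x))"
  using assms(1)
proof (induction k)
  case 0
  then have "continuous_on S (\<lambda>x. sqrt (h x))" by (auto intro: continuous_intros)
  moreover have "sqrt (h x) \<noteq> 0" if "x \<in> S" for x using assms(2)[OF that] by simp
  ultimately show ?case by (auto intro!: continuous_on_divide)
next
  case (Suc k)
  define r where "r = (\<lambda>x. 1 / sqrt (h x))"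
  obtain h' where d:
    "\<forall>x\<in>S. (h has_vector_derivative h' x) (at x within S)" "Ck k S h'"
    using Suc.prems by auto
  have IH: "Ck k S r"
    unfolding r_def using Suc Ck_SucD by blast
  have "(r has_real_derivative (- 1 / 2) * (h' x * (r x * (r x * r x)))) (at x within S)"
    if x: "x \<in> S" for x
  proof -
    have "(h has_real_derivative h' x) (at x within S)"
      using d x by (simp add: has_real_derivative_iff_has_vector_derivative)
    note [derivative_intros] = this
    have "sqrt (h x) * sqrt (h x) = h x"
      using assms(2)[OF x] by simp
    then show ?thesis
      unfolding r_def using assms(2)[OF x]
      by (auto intro!: derivative_eq_intros simp: field_simps)
  qed
  moreover have "Ck k S (\<lambda>x. (- 1 / 2) * (h' x * (r x * (r x * r x))))"
    by (intro Ck_mult Ck_const IH d)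
  ultimately show ?case
    unfolding r_def[symmetric] has_real_derivative_iff_has_vector_derivative by (rule Ck_SucI)
qed

lemma smooth_on_iff_Ck:
  assumes "proper_interval S"
  shows "smooth_on S h \<longleftrightarrow> (\<forall>k. Ck k S h)"
proof
  let ?D = "\<lambda>h x. vector_derivative h (at x within S)"
  assume h: "smooth_on S h"
  have "Ck k S ((?D ^^ n) h)" for k n
  proof (induction k arbitrary: n)
    case 0
    then show ?case
      using h by (auto simp: smooth_on_def intro: differentiable_imp_continuous_on)
  next
    case (Suc k)
    have "((?D ^^ n) h has_vector_derivative (?D ^^ Suc n) h x) (at x within S)" if "x \<in> S" for x
      using h that vector_derivative_works[of "(?D ^^ n) h"]
      by (auto simp: smooth_on_def differentiable_on_def)
    then show ?case using Suc[of "Suc n"] by (rule Ck_SucI)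
  qed
  from this[of _ 0] show "\<forall>k. Ck k S h" by simp
next
  let ?D = "\<lambda>h x. vector_derivative h (at x within S)"
  have "(?D ^^ n) h differentiable_on S" if "\<forall>k. Ck k S h" for n
    using that
  proof (induction n arbitrary: h)
    case 0
    then have "Ck (Suc 0) S h" by blast
    then show ?case
      by (auto simp: differentiable_on_def intro: differentiableI_vector)
  next
    case (Suc n)
    have "Ck k S (?D h)" for k
    proof -
      obtain h' where h': "\<forall>x\<in>S. (h has_vector_derivative h' x) (at x within S)" "Ck k S h'"
        using Suc.prems Ck.simps(2) by blast
      then show ?thesis
        using assms by (auto intro: Ck_cong simp: proper_interval_vector_derivative)
    qed
    then have "(?D ^^ n) (?D h) differentiable_on S" using Suc.IH by blast
    then show ?case by (simp only: funpow_Suc_right o_def)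
  qed
  then show "smooth_on S h" if "\<forall>k. Ck k S h"
    using that by (simp add: smooth_on_def)
qed

section \<open>Partial derivatives on rectangles\<close>

definition has_Du :: "real set \<Rightarrow> real set \<Rightarrow> (real \<Rightarrow> real \<Rightarrow> 'a::real_normed_vector) \<Rightarrow>
    (real \<Rightarrow> real \<Rightarrow> 'a) \<Rightarrow> bool" where
  "has_Du J I w w' \<longleftrightarrow>
     (\<forall>u\<in>J. \<forall>v\<in>I. ((\<lambda>s. w s v) has_vector_derivative w' u v) (at u within J))"

definition has_Dv :: "real set \<Rightarrow> real set \<Rightarrow> (real \<Rightarrow> real \<Rightarrow> 'a::real_normed_vector) \<Rightarrow>
    (real \<Rightarrow> real \<Rightarrow> 'a) \<Rightarrow> bool" where
  "has_Dv J I w w' \<longleftrightarrow>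
     (\<forall>u\<in>J. \<forall>v\<in>I. ((\<lambda>t. w u t) has_vector_derivative w' u v) (at v within I))"

lemma has_Du_cong:
  assumes "has_Du J I w w'" "\<And>u v. u \<in> J \<Longrightarrow> v \<in> I \<Longrightarrow> x u v = w u v"
  shows "has_Du J I x w'"
  unfolding has_Du_def
proof (intro ballI)
  fix u v assume uv: "u \<in> J" "v \<in> I"
  then have "((\<lambda>s. w s v) has_vector_derivative w' u v) (at u within J)"
    using assms(1) unfolding has_Du_def by blast
  then show "((\<lambda>s. x s v) has_vector_derivative w' u v) (at u within J)"
    by (rule has_vector_derivative_eq_on) (rule uv assms(2)[OF _ uv(2)] | assumption)+
qed

lemma has_Dv_cong:
  assumes "has_Dv J I w w'" "\<And>u v. u \<in> J \<Longrightarrow> v \<in> I \<Longrightarrow> x u v = w u v"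
  shows "has_Dv J I x w'"
  unfolding has_Dv_def
proof (intro ballI)
  fix u v assume uv: "u \<in> J" "v \<in> I"
  then have "((\<lambda>t. w u t) has_vector_derivative w' u v) (at v within I)"
    using assms(1) unfolding has_Dv_def by blast
  then show "((\<lambda>t. x u t) has_vector_derivative w' u v) (at v within I)"
    by (rule has_vector_derivative_eq_on) (rule uv assms(2)[OF uv(1)] | assumption)+
qed

lemma Du_eqI:
  assumes "proper_interval J" "has_Du J I w w'" "u \<in> J" "v \<in> I"
    and "\<And>u v. u \<in> J \<Longrightarrow> v \<in> I \<Longrightarrow> x u v = w u v"
  shows "Du J x u v = w' u v"
proof -
  have "has_Du J I x w'"
    using assms(2,5) by (rule has_Du_cong)
  then show ?thesis
    using assms(3,4) unfolding has_Du_def Du_def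
    by (blast intro: proper_interval_vector_derivative[OF assms(1)])
qed

lemma Dv_eqI:
  assumes "proper_interval I" "has_Dv J I w w'" "u \<in> J" "v \<in> I"
    and "\<And>u v. u \<in> J \<Longrightarrow> v \<in> I \<Longrightarrow> x u v = w u v"
  shows "Dv I x u v = w' u v"
proof -
  have "has_Dv J I x w'"
    using assms(2,5) by (rule has_Dv_cong)
  then show ?thesis
    using assms(3,4) unfolding has_Dv_def Dv_def
    by (blast intro: proper_interval_vector_derivative[OF assms(1)])
qed

lemma has_Du_Du: "Ck_on (Suc k) J I w \<Longrightarrow> has_Du J I w (Du J w)"
  by (simp add: has_Du_def Du_def vector_derivative_works)

lemma has_Dv_Dv: "Ck_on (Suc k) J I w \<Longrightarrow> has_Dv J I w (Dv I w)"
  by (simp add: has_Dv_def Dv_def vector_derivative_works)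

lemma differentiable_if_partials:
  assumes "has_Du J I w wu" "has_Dv J I w wv"
  shows "\<forall>u\<in>J. \<forall>v\<in>I. (\<lambda>s. w s v) differentiable (at u within J) \<and>
    (\<lambda>t. w u t) differentiable (at v within I)"
  using assms unfolding has_Du_def has_Dv_def by (blast intro: differentiableI_vector)

lemma Ck_on_cong:
  assumes "proper_interval J" "proper_interval I"
  shows "Ck_on k J I w' \<Longrightarrow> (\<And>u v. u \<in> J \<Longrightarrow> v \<in> I \<Longrightarrow> w u v = w' u v) \<Longrightarrow> Ck_on k J I w"
proof (induction k arbitrary: w w')
  case 0
  have "(\<lambda>(u, v). w u v) p = (\<lambda>(u, v). w' u v) p" if "p \<in> J \<times> I" for p
    using that 0(2) by (auto simp: split_beta)
  then show ?case using 0(1) by (simp cong: continuous_on_cong)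
next
  case (Suc k)
  have du: "has_Du J I w (Du J w')"
    by (rule has_Du_cong[OF has_Du_Du[OF Suc.prems(1)] Suc.prems(2)])
  have dv: "has_Dv J I w (Dv I w')"
    by (rule has_Dv_cong[OF has_Dv_Dv[OF Suc.prems(1)] Suc.prems(2)])
  have k: "Ck_on k J I (Du J w')" "Ck_on k J I (Dv I w')"
    using Suc.prems(1) by simp_all
  have "Ck_on k J I (Du J w)"
    by (rule Suc.IH[OF k(1)], rule Du_eqI[OF assms(1) du _ _ refl])
  moreover have "Ck_on k J I (Dv I w)"
    by (rule Suc.IH[OF k(2)], rule Dv_eqI[OF assms(2) dv _ _ refl])
  ultimately show ?case
    using differentiable_if_partials[OF du dv] by simp
qed

lemma Ck_on_SucI:
  assumes J: "proper_interval J" and I: "proper_interval I"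
    and du: "has_Du J I w wu" and dv: "has_Dv J I w wv"
    and k: "Ck_on k J I wu" "Ck_on k J I wv"
  shows "Ck_on (Suc k) J I w"
proof -
  have "Ck_on k J I (Du J w)"
    by (rule Ck_on_cong[OF J I k(1)], rule Du_eqI[OF J du _ _ refl])
  moreover have "Ck_on k J I (Dv I w)"
    by (rule Ck_on_cong[OF J I k(2)], rule Dv_eqI[OF I dv _ _ refl])
  ultimately show ?thesis
    using differentiable_if_partials[OF du dv] by (simp only: Ck_on.simps)
qed

lemma Ck_on_add:
  assumes "proper_interval J" "proper_interval I"
  shows "Ck_on k J I w \<Longrightarrow> Ck_on k J I x \<Longrightarrow> Ck_on k J I (\<lambda>u v. w u v + x u v)"
proof (induction k arbitrary: w x)
  case 0
  then show ?case by (simp add: split_beta continuous_on_add)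
next
  case (Suc k)
  have "has_Du J I (\<lambda>u v. w u v + x u v) (\<lambda>u v. Du J w u v + Du J x u v)"
    using Suc.prems[THEN has_Du_Du] by (simp add: has_Du_def has_vector_derivative_add)
  moreover have "has_Dv J I (\<lambda>u v. w u v + x u v) (\<lambda>u v. Dv I w u v + Dv I x u v)"
    using Suc.prems[THEN has_Dv_Dv] by (simp add: has_Dv_def has_vector_derivative_add)
  moreover have "Ck_on k J I (\<lambda>u v. Du J w u v + Du J x u v)"
    "Ck_on k J I (\<lambda>u v. Dv I w u v + Dv I x u v)"
    using Suc.prems by (auto intro: Suc.IH)
  ultimately show ?case
    by (rule Ck_on_SucI[OF assms])
qed

lemma Ck_on_separated:
  fixes p :: "real \<Rightarrow> real"
  assumes "proper_interval J" "proper_interval I"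
  shows "Ck k J p \<Longrightarrow> Ck k I q \<Longrightarrow> Ck_on k J I (\<lambda>u v. p u *\<^sub>R q v)"
proof (induction k arbitrary: p q)
  case 0
  have "continuous_on (J \<times> I) (\<lambda>x. p (fst x))" "continuous_on (J \<times> I) (\<lambda>x. q (snd x))"
    using 0 by (auto intro!: continuous_on_compose2[of J p] continuous_on_compose2[of I q]
        continuous_on_fst continuous_on_snd continuous_on_id)
  then show ?case by (simp add: split_beta continuous_on_scaleR)
next
  case (Suc k)
  obtain p' where p': "\<forall>x\<in>J. (p has_vector_derivative p' x) (at x within J)" "Ck k J p'"
    using Suc.prems(1) by auto
  obtain q' where q': "\<forall>x\<in>I. (q has_vector_derivative q' x) (at x within I)" "Ck k I q'"
    using Suc.prems(2) by auto
  have "has_Du J I (\<lambda>u v. p u *\<^sub>R q v) (\<lambda>u v. p' u *\<^sub>R q v)"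
    using p'(1) unfolding has_Du_def
    by (blast intro: bounded_linear.has_vector_derivative[OF bounded_linear_scaleR_left])
  moreover have "has_Dv J I (\<lambda>u v. p u *\<^sub>R q v) (\<lambda>u v. p u *\<^sub>R q' v)"
    using q'(1) unfolding has_Dv_def
    by (blast intro: bounded_linear.has_vector_derivative[OF bounded_linear_scaleR_right])
  moreover have "Ck_on k J I (\<lambda>u v. p' u *\<^sub>R q v)" "Ck_on k J I (\<lambda>u v. p u *\<^sub>R q' v)"
    by (rule Suc.IH[OF p'(2) Ck_SucD[OF Suc.prems(2)]], rule Suc.IH[OF Ck_SucD[OF Suc.prems(1)] q'(2)])
  ultimately show ?case
    by (rule Ck_on_SucI[OF assms])
qed

text \<open>
  The mean value theorem is applied in the first variable and then in the second one, which brings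
  in \<open>wuv\<close>; exchanging the roles of the variables yields the other mixed partial derivative.
\<close>

lemma second_difference_mvt:
  fixes w :: "real \<Rightarrow> real \<Rightarrow> real"
  assumes "is_interval J" "is_interval I"
    and "has_Du J I w wu" "has_Dv J I wu wuv"
    and "u \<in> J" "u' \<in> J" "v \<in> I" "v' \<in> I"
  obtains \<xi> \<eta> where "\<xi> \<in> J" "\<eta> \<in> I" "\<bar>\<xi> - u\<bar> \<le> \<bar>u' - u\<bar>" "\<bar>\<eta> - v\<bar> \<le> \<bar>v' - v\<bar>"
    "w u' v' - w u v' - w u' v + w u v = (u' - u) * (v' - v) * wuv \<xi> \<eta>"
proof -
  have *: "((\<lambda>s. w s v' - w s v) has_vector_derivative wu x v' - wu x v) (at x within J)" if "x \<in> J" for x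
    using that assms by (intro has_vector_derivative_diff) (auto simp: has_Du_def)
  obtain \<xi> where \<xi>: "\<xi> \<in> J" "\<bar>\<xi> - u\<bar> \<le> \<bar>u' - u\<bar>"
    "(w u' v' - w u' v) - (w u v' - w u v) = (u' - u) * (wu \<xi> v' - wu \<xi> v)"
    by (rule mvt_in_interval[OF assms(1,5,6) *])
  have **: "(wu \<xi> has_vector_derivative wuv \<xi> x) (at x within I)" if "x \<in> I" for x
    using that assms \<xi>(1) by (simp add: has_Dv_def)
  obtain \<eta> where \<eta>: "\<eta> \<in> I" "\<bar>\<eta> - v\<bar> \<le> \<bar>v' - v\<bar>" "wu \<xi> v' - wu \<xi> v = (v' - v) * wuv \<xi> \<eta>"
    by (rule mvt_in_interval[OF assms(2,7,8) **])
  show ?thesis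
    using \<xi> \<eta> by (intro that[of \<xi> \<eta>]) (simp_all add: algebra_simps)
qed

text \<open>
  Both orders of differentiation evaluate the same second difference, so the two mixed partials
  agree at points arbitrarily close to \<open>(u, v)\<close>. Since \<open>(u, v)\<close> is only a limit point of its
  rectangle, the argument covers the boundary.
\<close>

lemma mixed_partials_eq:
  fixes w :: "real \<Rightarrow> real \<Rightarrow> real"
  assumes J: "proper_interval J" and I: "proper_interval I"
    and d: "has_Du J I w wu" "has_Dv J I w wv" "has_Dv J I wu wuv" "has_Du J I wv wvu"
    and c: "continuous_on (J \<times> I) (\<lambda>(u, v). wuv u v)" "continuous_on (J \<times> I) (\<lambda>(u, v). wvu u v)"
    and uv: "u \<in> J" "v \<in> I"
  shows "wuv u v = wvu u v"
proof (rule ccontr)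
  assume ne: "wuv u v \<noteq> wvu u v"
  define \<epsilon> where "\<epsilon> = \<bar>wuv u v - wvu u v\<bar> / 2"
  have "\<epsilon> > 0" using ne by (simp add: \<epsilon>_def)
  obtain \<delta>1 where \<delta>1: "\<delta>1 > 0"
    "\<And>p. p \<in> J \<times> I \<Longrightarrow> dist p (u, v) < \<delta>1 \<Longrightarrow> dist (wuv (fst p) (snd p)) (wuv u v) < \<epsilon>"
    using c(1) uv \<open>\<epsilon> > 0\<close> unfolding continuous_on_iff split_beta
    by (metis SigmaI fst_conv snd_conv)
  obtain \<delta>2 where \<delta>2: "\<delta>2 > 0"
    "\<And>p. p \<in> J \<times> I \<Longrightarrow> dist p (u, v) < \<delta>2 \<Longrightarrow> dist (wvu (fst p) (snd p)) (wvu u v) < \<epsilon>"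
    using c(2) uv \<open>\<epsilon> > 0\<close> unfolding continuous_on_iff split_beta
    by (metis SigmaI fst_conv snd_conv)
  define \<delta> where "\<delta> = min \<delta>1 \<delta>2 / 3"
  have "\<delta> > 0" using \<delta>1 \<delta>2 by (simp add: \<delta>_def)
  obtain u' where u': "u' \<in> J" "u' \<noteq> u" "\<bar>u' - u\<bar> \<le> \<delta>"
    using proper_interval_islimpt[OF J uv(1)] \<open>\<delta> > 0\<close>
    unfolding islimpt_approachable_le by (auto simp: dist_real_def)
  obtain v' where v': "v' \<in> I" "v' \<noteq> v" "\<bar>v' - v\<bar> \<le> \<delta>"
    using proper_interval_islimpt[OF I uv(2)] \<open>\<delta> > 0\<close>
    unfolding islimpt_approachable_le by (auto simp: dist_real_def)
  have near: "dist (\<xi>, \<eta>) (u, v) < min \<delta>1 \<delta>2"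
    if "\<bar>\<xi> - u\<bar> \<le> \<bar>u' - u\<bar>" "\<bar>\<eta> - v\<bar> \<le> \<bar>v' - v\<bar>" for \<xi> \<eta>
  proof -
    have "dist (\<xi>, \<eta>) (u, v) \<le> \<bar>\<xi> - u\<bar> + \<bar>\<eta> - v\<bar>"
      by (auto simp: dist_Pair_Pair dist_real_def intro: order_trans[OF sqrt_sum_squares_le_sum_abs])
    then show ?thesis using that u' v' \<open>\<delta> > 0\<close> unfolding \<delta>_def by linarith
  qed
  have int: "is_interval J" "is_interval I"
    using J I by (auto simp: proper_interval_def)
  obtain \<xi> \<eta> where 1: "\<xi> \<in> J" "\<eta> \<in> I" "\<bar>\<xi> - u\<bar> \<le> \<bar>u' - u\<bar>" "\<bar>\<eta> - v\<bar> \<le> \<bar>v' - v\<bar>"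
    "w u' v' - w u v' - w u' v + w u v = (u' - u) * (v' - v) * wuv \<xi> \<eta>"
    using second_difference_mvt[OF int d(1,3) uv(1) u'(1) uv(2) v'(1)] by blast
  obtain \<eta>' \<xi>' where 2: "\<xi>' \<in> J" "\<eta>' \<in> I" "\<bar>\<xi>' - u\<bar> \<le> \<bar>u' - u\<bar>" "\<bar>\<eta>' - v\<bar> \<le> \<bar>v' - v\<bar>"
    "w u' v' - w u' v - w u v' + w u v = (v' - v) * (u' - u) * wvu \<xi>' \<eta>'"
    using second_difference_mvt[OF int(2,1), of "\<lambda>v u. w u v" "\<lambda>v u. wv u v" "\<lambda>v u. wvu u v" v v' u u'
        thesis] d(2,4) uv u' v' by (auto simp: has_Du_def has_Dv_def)
  have "(u' - u) * (v' - v) * wuv \<xi> \<eta> = (u' - u) * (v' - v) * wvu \<xi>' \<eta>'"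
    using 1(5) 2(5) by (simp add: algebra_simps)
  then have "wuv \<xi> \<eta> = wvu \<xi>' \<eta>'" using u' v' by simp
  moreover have "dist (wuv \<xi> \<eta>) (wuv u v) < \<epsilon>"
    using \<delta>1(2)[of "(\<xi>, \<eta>)"] near[of \<xi> \<eta>] 1 by simp
  moreover have "dist (wvu \<xi>' \<eta>') (wvu u v) < \<epsilon>"
    using \<delta>2(2)[of "(\<xi>', \<eta>')"] near[of \<xi>' \<eta>'] 2 by simp
  ultimately show False
    by (simp add: \<epsilon>_def dist_real_def) (smt (verit) field_sum_of_halves)
qed

definition has_symmetric_partials :: "real set \<Rightarrow> real set \<Rightarrow>
    (real \<Rightarrow> real \<Rightarrow> 'a::real_normed_vector) \<Rightarrow> (real \<Rightarrow> real \<Rightarrow> 'a) \<Rightarrow> (real \<Rightarrow> real \<Rightarrow> 'a) \<Rightarrow>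
    (real \<Rightarrow> real \<Rightarrow> 'a) \<Rightarrow> bool" where
  "has_symmetric_partials J I w wu wv wuv \<longleftrightarrow>
     has_Du J I w wu \<and> has_Dv J I w wv \<and> has_Dv J I wu wuv \<and> has_Du J I wv wuv"

lemma Ck_on_symmetric_partials:
  fixes w :: "real \<Rightarrow> real \<Rightarrow> real^'n"
  assumes J: "proper_interval J" and I: "proper_interval I" and w: "Ck_on 2 J I w"
  shows "has_symmetric_partials J I w (Du J w) (Dv I w) (Dv I (Du J w))"
proof -
  have w: "Ck_on (Suc (Suc 0)) J I w" using w by (simp add: numeral_2_eq_2)
  have d: "has_Du J I w (Du J w)" "has_Dv J I w (Dv I w)"
    "has_Dv J I (Du J w) (Dv I (Du J w))" "has_Du J I (Dv I w) (Du J (Dv I w))"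
    using has_Du_Du[OF w] has_Dv_Dv[OF w] has_Dv_Dv[of 0 J I "Du J w"] has_Du_Du[of 0 J I "Dv I w"] w
    by simp_all
  have comp: "has_Du J I (\<lambda>u v. x u v $ i) (\<lambda>u v. x' u v $ i)" if "has_Du J I x x'"
    for x x' :: "real \<Rightarrow> real \<Rightarrow> real^'n" and i
    using that unfolding has_Du_def
    by (intro ballI bounded_linear.has_vector_derivative[OF bounded_linear_vec_nth]) simp
  have comp': "has_Dv J I (\<lambda>u v. x u v $ i) (\<lambda>u v. x' u v $ i)" if "has_Dv J I x x'"
    for x x' :: "real \<Rightarrow> real \<Rightarrow> real^'n" and i
    using that unfolding has_Dv_def
    by (intro ballI bounded_linear.has_vector_derivative[OF bounded_linear_vec_nth]) simp
  have cont: "continuous_on (J \<times> I) (\<lambda>(u, v). Dv I (Du J w) u v $ i)"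
    "continuous_on (J \<times> I) (\<lambda>(u, v). Du J (Dv I w) u v $ i)" for i
    using w by (auto simp: split_beta intro: continuous_on_component)
  have "Dv I (Du J w) u v = Du J (Dv I w) u v" if "u \<in> J" "v \<in> I" for u v
    unfolding vec_eq_iff
    using mixed_partials_eq[OF J I comp[OF d(1)] comp'[OF d(2)] comp'[OF d(3)] comp[OF d(4)] cont that]
    by blast
  with d(4) have "has_Du J I (Dv I w) (Dv I (Du J w))"
    unfolding has_Du_def by simp
  then show ?thesis
    using d by (simp add: has_symmetric_partials_def)
qed

lemma has_symmetric_partials_bilinear:
  assumes bop: "bounded_bilinear bop"
    and x: "has_symmetric_partials J I x xu xv xuv" and y: "has_symmetric_partials J I y yu yv yuv"
  shows "has_symmetric_partials J I (\<lambda>u v. bop (x u v) (y u v))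
    (\<lambda>u v. bop (x u v) (yu u v) + bop (xu u v) (y u v))
    (\<lambda>u v. bop (x u v) (yv u v) + bop (xv u v) (y u v))
    (\<lambda>u v. (bop (x u v) (yuv u v) + bop (xv u v) (yu u v)) +
            (bop (xu u v) (yv u v) + bop (xuv u v) (y u v)))"
proof -
  note D = bounded_bilinear.has_vector_derivative[OF bop]
  have x': "has_Du J I x xu" "has_Dv J I x xv" "has_Dv J I xu xuv" "has_Du J I xv xuv"
    and y': "has_Du J I y yu" "has_Dv J I y yv" "has_Dv J I yu yuv" "has_Du J I yv yuv"
    using x y by (simp_all add: has_symmetric_partials_def)
  have "has_Du J I (\<lambda>u v. bop (x u v) (y u v)) (\<lambda>u v. bop (x u v) (yu u v) + bop (xu u v) (y u v))"
    using x'(1) y'(1) unfolding has_Du_def by (intro ballI D) simp_all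
  moreover have "has_Dv J I (\<lambda>u v. bop (x u v) (y u v)) (\<lambda>u v. bop (x u v) (yv u v) + bop (xv u v) (y u v))"
    using x'(2) y'(2) unfolding has_Dv_def by (intro ballI D) simp_all
  moreover have "has_Dv J I (\<lambda>u v. bop (x u v) (yu u v) + bop (xu u v) (y u v))
    (\<lambda>u v. (bop (x u v) (yuv u v) + bop (xv u v) (yu u v)) +
            (bop (xu u v) (yv u v) + bop (xuv u v) (y u v)))"
    using x'(2,3) y'(2,3) unfolding has_Dv_def by (intro ballI has_vector_derivative_add D) simp_all
  moreover have "has_Du J I (\<lambda>u v. bop (x u v) (yv u v) + bop (xv u v) (y u v))
    (\<lambda>u v. (bop (x u v) (yuv u v) + bop (xu u v) (yv u v)) +
            (bop (xv u v) (yu u v) + bop (xuv u v) (y u v)))"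
    using x'(1,4) y'(1,4) unfolding has_Du_def by (intro ballI has_vector_derivative_add D) simp_all
  ultimately show ?thesis
    unfolding has_symmetric_partials_def by (simp add: add_ac)
qed

section \<open>The hyperbolically rotating frame\<close>

text \<open>
  \<open>rot_vec \<alpha> \<beta> a b c d v\<close> is the vector with coordinates \<open>a, b, c, d\<close> in the orthonormal frame
  of \<open>\<real>\<^sup>4\<close> (signature \<open>+ + - -\<close>) that is moved along by the hyperbolic rotation with parameter
  \<open>v\<close>. A rotational surface is \<open>rot_vec \<alpha> \<beta> (f u) (g u) 0 0 v\<close>, and its derivatives and normal
  vectors also have coordinates that depend on \<open>u\<close> only.
\<close>

definition rot_vec :: "real \<Rightarrow> real \<Rightarrow> real \<Rightarrow> real \<Rightarrow> real \<Rightarrow> real \<Rightarrow> real \<Rightarrow> real^4" where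
  "rot_vec \<alpha> \<beta> a b c d v =
     vector [a * cosh (\<alpha> * v) + c * sinh (\<alpha> * v), b * cosh (\<beta> * v) + d * sinh (\<beta> * v),
             a * sinh (\<alpha> * v) + c * cosh (\<alpha> * v), b * sinh (\<beta> * v) + d * cosh (\<beta> * v)]"

lemma vector_4_nth [simp]:
  fixes a b c d :: "'a::zero"
  shows "(vector [a, b, c, d] :: 'a^4) $ 1 = a" "(vector [a, b, c, d] :: 'a^4) $ 2 = b"
    "(vector [a, b, c, d] :: 'a^4) $ 3 = c" "(vector [a, b, c, d] :: 'a^4) $ 4 = d"
  by (simp_all add: vector_def)

lemma rot_surf_hyp_eq_rot_vec: "rot_surf_hyp \<alpha> \<beta> f g u v = rot_vec \<alpha> \<beta> (f u) (g u) 0 0 v"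
  by (simp add: rot_surf_hyp_def rot_vec_def)

lemma rot_vec_add:
  "rot_vec \<alpha> \<beta> a b c d v + rot_vec \<alpha> \<beta> a' b' c' d' v = rot_vec \<alpha> \<beta> (a + a') (b + b') (c + c') (d + d') v"
  by (simp add: rot_vec_def vec_eq_iff forall_4 algebra_simps)

lemma rot_vec_diff:
  "rot_vec \<alpha> \<beta> a b c d v - rot_vec \<alpha> \<beta> a' b' c' d' v = rot_vec \<alpha> \<beta> (a - a') (b - b') (c - c') (d - d') v"
  by (simp add: rot_vec_def vec_eq_iff forall_4 algebra_simps)

lemma rot_vec_scaleR:
  "k *\<^sub>R rot_vec \<alpha> \<beta> a b c d v = rot_vec \<alpha> \<beta> (k * a) (k * b) (k * c) (k * d) v"
  by (simp add: rot_vec_def vec_eq_iff forall_4 algebra_simps)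

lemma rot_vec_0: "rot_vec \<alpha> \<beta> 0 0 0 0 v = 0"
  by (simp add: rot_vec_def vec_eq_iff forall_4)

lemma ip42_rot_vec:
  "ip42 (rot_vec \<alpha> \<beta> a b c d v) (rot_vec \<alpha> \<beta> a' b' c' d' v) = a * a' + b * b' - c * c' - d * d'"
proof -
  have *: "(x * C + y * S) * (x' * C + y' * S) - (x * S + y * C) * (x' * S + y' * C) = x * x' - y * y'"
    if "C\<^sup>2 = S\<^sup>2 + 1" for x y x' y' C S :: real
  proof -
    have "(x * C + y * S) * (x' * C + y' * S) - (x * S + y * C) * (x' * S + y' * C)
      = (C\<^sup>2 - S\<^sup>2) * (x * x' - y * y')"
      by (simp add: algebra_simps power2_eq_square)
    then show ?thesis using that by simp
  qed
  show ?thesis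
    using *[OF cosh_square_eq, of a "\<alpha> * v" c a' c'] *[OF cosh_square_eq, of b "\<beta> * v" d b' d']
    by (simp add: ip42_def rot_vec_def)
qed

lemma rot_vec_exhaust:
  obtains a b c d where "w = rot_vec \<alpha> \<beta> a b c d v"
proof
  have *: "(x * C - y * S) * C + (y * C - x * S) * S = x \<and> (x * C - y * S) * S + (y * C - x * S) * C = y"
    if "C\<^sup>2 = S\<^sup>2 + 1" for x y C S :: real
  proof -
    have "(x * C - y * S) * C + (y * C - x * S) * S = (C\<^sup>2 - S\<^sup>2) * x"
      "(x * C - y * S) * S + (y * C - x * S) * C = (C\<^sup>2 - S\<^sup>2) * y"
      by (simp_all add: algebra_simps power2_eq_square)
    then show ?thesis using that by simp
  qed
  show "w = rot_vec \<alpha> \<beta>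
    (w $ 1 * cosh (\<alpha> * v) - w $ 3 * sinh (\<alpha> * v)) (w $ 2 * cosh (\<beta> * v) - w $ 4 * sinh (\<beta> * v))
    (w $ 3 * cosh (\<alpha> * v) - w $ 1 * sinh (\<alpha> * v)) (w $ 4 * cosh (\<beta> * v) - w $ 2 * sinh (\<beta> * v)) v"
    using *[OF cosh_square_eq, of "w $ 1" "\<alpha> * v" "w $ 3"] *[OF cosh_square_eq, of "w $ 2" "\<beta> * v" "w $ 4"]
    by (simp add: rot_vec_def vec_eq_iff forall_4)
qed

lemma has_vector_derivative_vecI:
  fixes h :: "real \<Rightarrow> real^'n"
  assumes "\<And>i. ((\<lambda>x. h x $ i) has_vector_derivative h' $ i) F"
  shows "(h has_vector_derivative h') F"
proof -
  have "((\<lambda>x. \<Sum>i\<in>UNIV. (h x $ i) *\<^sub>R axis i (1::real)) has_vector_derivative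
      (\<Sum>i\<in>UNIV. (h' $ i) *\<^sub>R axis i 1)) F"
    by (intro has_vector_derivative_sum
        bounded_linear.has_vector_derivative[OF bounded_linear_scaleR_left] assms)
  then show ?thesis
    by (simp add: basis_expansion scalar_mult_eq_scaleR[symmetric])
qed

lemma rot_vec_has_vector_derivative_coords:
  assumes "(a has_vector_derivative a') (at u within S)" "(b has_vector_derivative b') (at u within S)"
    "(c has_vector_derivative c') (at u within S)" "(d has_vector_derivative d') (at u within S)"
  shows "((\<lambda>s. rot_vec \<alpha> \<beta> (a s) (b s) (c s) (d s) v) has_vector_derivative rot_vec \<alpha> \<beta> a' b' c' d' v)
    (at u within S)"
proof (rule has_vector_derivative_vecI)
  note assms[folded has_real_derivative_iff_has_vector_derivative, derivative_intros]
  show "((\<lambda>s. rot_vec \<alpha> \<beta> (a s) (b s) (c s) (d s) v $ i) has_vector_derivative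
    rot_vec \<alpha> \<beta> a' b' c' d' v $ i) (at u within S)" for i
    unfolding has_real_derivative_iff_has_vector_derivative[symmetric]
    using exhaust_4[of i] by (auto simp: rot_vec_def intro!: derivative_eq_intros)
qed

lemma rot_vec_has_vector_derivative:
  assumes "(a has_vector_derivative a') (at v within S)" "(b has_vector_derivative b') (at v within S)"
    "(c has_vector_derivative c') (at v within S)" "(d has_vector_derivative d') (at v within S)"
  shows "((\<lambda>t. rot_vec \<alpha> \<beta> (a t) (b t) (c t) (d t) t) has_vector_derivative
    rot_vec \<alpha> \<beta> (a' + \<alpha> * c v) (b' + \<beta> * d v) (c' + \<alpha> * a v) (d' + \<beta> * b v) v) (at v within S)"
proof (rule has_vector_derivative_vecI)
  note assms[folded has_real_derivative_iff_has_vector_derivative, derivative_intros]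
  show "((\<lambda>t. rot_vec \<alpha> \<beta> (a t) (b t) (c t) (d t) t $ i) has_vector_derivative
    rot_vec \<alpha> \<beta> (a' + \<alpha> * c v) (b' + \<beta> * d v) (c' + \<alpha> * a v) (d' + \<beta> * b v) v $ i) (at v within S)" for i
    unfolding has_real_derivative_iff_has_vector_derivative[symmetric]
    using exhaust_4[of i]
    by (auto simp: rot_vec_def algebra_simps intro!: derivative_eq_intros)
qed

lemma rot_vec_has_vector_derivative_const:
  "((\<lambda>t. rot_vec \<alpha> \<beta> a b c d t) has_vector_derivative
    rot_vec \<alpha> \<beta> (\<alpha> * c) (\<beta> * d) (\<alpha> * a) (\<beta> * b) v) (at v within S)"
  using rot_vec_has_vector_derivative[of "\<lambda>_. a" 0 v S "\<lambda>_. b" 0 "\<lambda>_. c" 0 "\<lambda>_. d" 0 \<alpha> \<beta>]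
  by simp

lemma Ck_rot_vec: "Ck k S (rot_vec \<alpha> \<beta> a b c d)"
proof (induction k arbitrary: a b c d)
  case 0
  then show ?case
    using rot_vec_has_vector_derivative_const[THEN has_vector_derivative_continuous]
    by (simp add: continuous_on_eq_continuous_within)
next
  case (Suc k)
  show ?case
    by (rule Ck_SucI[OF rot_vec_has_vector_derivative_const Suc.IH])
qed

lemma bounded_bilinear_ip42: "bounded_bilinear ip42"
  unfolding bilinear_conv_bounded_bilinear[symmetric] bilinear_def
  by (auto simp: ip42_def algebra_simps intro!: linearI)

lemma bounded_bilinear_minus_ip42: "bounded_bilinear (\<lambda>x y. - ip42 x y)"
  unfolding bilinear_conv_bounded_bilinear[symmetric] bilinear_def
  by (auto simp: ip42_def algebra_simps intro!: linearI)

lemma ip42_add_left: "ip42 (x + y) z = ip42 x z + ip42 y z"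
  and ip42_scaleR_left: "ip42 (k *\<^sub>R x) z = k * ip42 x z"
  by (simp_all add: ip42_def algebra_simps)

section \<open>Normal connection and mean curvature of a rotational surface\<close>

lemma smooth_deriv_in:
  assumes S: "proper_interval S" and h: "\<And>k. Ck k S h"
  shows "x \<in> S \<Longrightarrow> (h has_vector_derivative deriv_in S h x) (at x within S)"
    and "Ck k S (deriv_in S h)"
proof -
  have ex: "\<exists>h'. (\<forall>x\<in>S. (h has_vector_derivative h' x) (at x within S)) \<and> Ck k S h'" for k
    using h[of "Suc k"] by simp
  then show "x \<in> S \<Longrightarrow> (h has_vector_derivative deriv_in S h x) (at x within S)"
    unfolding deriv_in_def using proper_interval_vector_derivative[OF S] by metis
  obtain h' where h': "\<forall>x\<in>S. (h has_vector_derivative h' x) (at x within S)" "Ck k S h'"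
    using ex by blast
  have "deriv_in S h x = h' x" if "x \<in> S" for x
    unfolding deriv_in_def using h'(1) that by (intro proper_interval_vector_derivative[OF S]) auto
  then show "Ck k S (deriv_in S h)"
    by (rule Ck_cong[OF h'(2)])
qed

locale hyperbolic_rotational_surface =
  fixes \<alpha> \<beta> :: real and f g :: "real \<Rightarrow> real" and J :: "real set"
  assumes \<alpha>_pos: "\<alpha> > 0" and \<beta>_pos: "\<beta> > 0"
    and J: "proper_interval J"
    and smooth_f: "smooth_on J f" and smooth_g: "smooth_on J g"
    and L_pos': "\<forall>u\<in>J. \<alpha>\<^sup>2 * (f u)\<^sup>2 + \<beta>\<^sup>2 * (g u)\<^sup>2 > 0"
    and E_pos': "\<forall>u\<in>J. (deriv_in J f u)\<^sup>2 + (deriv_in J g u)\<^sup>2 > 0"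
begin

abbreviation "I \<equiv> {0..<2*pi}"
abbreviation "Z \<equiv> rot_surf_hyp \<alpha> \<beta> f g"
abbreviation "rv \<equiv> rot_vec \<alpha> \<beta>"

definition "f1 = deriv_in J f"
definition "g1 = deriv_in J g"
definition "f2 = deriv_in J f1"
definition "g2 = deriv_in J g1"

definition "E u = (f1 u)\<^sup>2 + (g1 u)\<^sup>2"
definition "L u = \<alpha>\<^sup>2 * (f u)\<^sup>2 + \<beta>\<^sup>2 * (g u)\<^sup>2"

text \<open>
  \<open>rv (P1 u) (P2 u) 0 0 v\<close> is a unit normal vector of square \<open>1\<close> and \<open>rv 0 0 (Q1 u) (Q2 u) v\<close>
  is one of square \<open>-1\<close>. They are orthogonal, and \<open>normal_vec p q\<close> is the normal vector with the
  coefficients \<open>p\<close> and \<open>q\<close> in this frame. The four coefficients are spelled as products because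
  their smoothness then follows from that of the factors.
\<close>

definition "P1 u = g1 u * (1 / sqrt (E u))"
definition "P2 u = - 1 * (f1 u * (1 / sqrt (E u)))"
definition "Q1 u = \<beta> * (g u * (1 / sqrt (L u)))"
definition "Q2 u = (- \<alpha>) * (f u * (1 / sqrt (L u)))"

definition normal_vec :: "real \<Rightarrow> real \<Rightarrow> surf" where
  "normal_vec p q u v = rv (p * P1 u) (p * P2 u) (q * Q1 u) (q * Q2 u) v"

text \<open>
  The component of the derivative of one unit normal along the other one in the direction \<open>v\<close>, that is
  the connection form of the normal connection.
\<close>

definition "\<kappa> u = \<alpha> * (P1 u * Q1 u) + \<beta> * (P2 u * Q2 u)"

lemma I: "proper_interval I"
proof -
  have "interior I = {0<..<2*pi}"
    by simp
  moreover have "pi \<in> {0<..<2*pi}"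
    using pi_gt_zero by simp
  ultimately have "interior I \<noteq> {}"
    by blast
  then show ?thesis
    unfolding proper_interval_def by (simp add: is_interval_1)
qed

lemma E_pos: "u \<in> J \<Longrightarrow> E u > 0" and L_pos: "u \<in> J \<Longrightarrow> L u > 0"
  using E_pos' L_pos' by (simp_all add: E_def L_def f1_def g1_def)

lemma Ck_f: "Ck k J f" and Ck_g: "Ck k J g"
  using smooth_f smooth_g J by (simp_all add: smooth_on_iff_Ck)

lemma Ck_f1: "Ck k J f1" and Ck_g1: "Ck k J g1"
  unfolding f1_def g1_def using smooth_deriv_in(2)[OF J] Ck_f Ck_g by blast+

lemma Ck_E: "Ck k J E"
  unfolding E_def[abs_def] power2_eq_square by (intro Ck_add Ck_mult Ck_f1 Ck_g1)

lemma Ck_L: "Ck k J L"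
  unfolding L_def[abs_def] power2_eq_square by (intro Ck_add Ck_mult Ck_const Ck_f Ck_g)

lemma Ck_frame: "Ck k J P1" "Ck k J P2" "Ck k J Q1" "Ck k J Q2"
  unfolding P1_def[abs_def] P2_def[abs_def] Q1_def[abs_def] Q2_def[abs_def]
  by (intro Ck_mult Ck_const Ck_f Ck_g Ck_f1 Ck_g1 Ck_inverse_sqrt Ck_E Ck_L E_pos L_pos; assumption)+

lemma Ck_\<kappa>: "Ck k J \<kappa>"
  unfolding \<kappa>_def[abs_def] by (intro Ck_add Ck_mult Ck_const Ck_frame)

lemmas f_deriv = smooth_deriv_in(1)[OF J Ck_f, folded f1_def]
  and g_deriv = smooth_deriv_in(1)[OF J Ck_g, folded g1_def]
  and f1_deriv = smooth_deriv_in(1)[OF J Ck_f1, folded f2_def]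
  and g1_deriv = smooth_deriv_in(1)[OF J Ck_g1, folded g2_def]
  and \<kappa>_deriv = smooth_deriv_in(1)[OF J Ck_\<kappa>]

lemma P_prods:
  assumes "u \<in> J"
  shows "P1 u * P1 u = (g1 u)\<^sup>2 / E u" "P2 u * P2 u = (f1 u)\<^sup>2 / E u"
    "P1 u * P2 u = - (f1 u * g1 u) / E u"
  using E_pos[OF assms] by (simp_all add: P1_def P2_def power2_eq_square)

lemma Q_prods:
  assumes "u \<in> J"
  shows "Q1 u * Q1 u = (\<beta> * g u)\<^sup>2 / L u" "Q2 u * Q2 u = (\<alpha> * f u)\<^sup>2 / L u"
    "Q1 u * Q2 u = - (\<alpha> * f u * (\<beta> * g u)) / L u"
  using L_pos[OF assms] by (simp_all add: Q1_def Q2_def power2_eq_square)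

lemma P_unit: "u \<in> J \<Longrightarrow> P1 u * P1 u + P2 u * P2 u = 1"
  using E_pos[of u] by (simp add: P_prods add_divide_distrib[symmetric]) (simp add: E_def add.commute)

lemma Q_unit: "u \<in> J \<Longrightarrow> Q1 u * Q1 u + Q2 u * Q2 u = 1"
  using L_pos[of u]
  by (simp add: Q_prods add_divide_distrib[symmetric]) (simp add: L_def add.commute power_mult_distrib)

lemma P_orth: "f1 u * P1 u + g1 u * P2 u = 0"
  by (simp add: P1_def P2_def)

lemma Q_orth: "\<alpha> * f u * Q1 u + \<beta> * g u * Q2 u = 0"
  by (simp add: Q1_def Q2_def)

text \<open>A unit vector in a Euclidean plane is orthogonal to its derivative.\<close>

lemma unit_deriv_orth:
  assumes "\<And>k. Ck k J a" "\<And>k. Ck k J b" "\<And>u. u \<in> J \<Longrightarrow> a u * a u + b u * b u = 1" "u \<in> J"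
  shows "a u * deriv_in J a u + b u * deriv_in J b u = 0"
proof -
  note smooth_deriv_in(1)[OF J assms(1), folded has_real_derivative_iff_has_vector_derivative, derivative_intros]
    smooth_deriv_in(1)[OF J assms(2), folded has_real_derivative_iff_has_vector_derivative, derivative_intros]
  have "((\<lambda>u. a u * a u + b u * b u) has_real_derivative
      2 * (a u * deriv_in J a u + b u * deriv_in J b u)) (at u within J)"
    using assms(4) by (auto intro!: derivative_eq_intros)
  then have "((\<lambda>u. 1) has_vector_derivative
      2 * (a u * deriv_in J a u + b u * deriv_in J b u)) (at u within J)"
    unfolding has_real_derivative_iff_has_vector_derivative
    by (rule has_vector_derivative_eq_on[OF _ assms(4)]) (rule assms(3)[symmetric])
  from trans[OF proper_interval_vector_derivative[OF J assms(4) this, symmetric]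
      proper_interval_vector_derivative[OF J assms(4) has_vector_derivative_const[of "1::real"]]]
  show ?thesis
    by (simp only: mult_eq_0_iff) simp
qed

lemma P_deriv_orth: "u \<in> J \<Longrightarrow> P1 u * deriv_in J P1 u + P2 u * deriv_in J P2 u = 0"
  by (rule unit_deriv_orth[OF Ck_frame(1,2) P_unit])

lemma Q_deriv_orth: "u \<in> J \<Longrightarrow> Q1 u * deriv_in J Q1 u + Q2 u * deriv_in J Q2 u = 0"
  by (rule unit_deriv_orth[OF Ck_frame(3,4) Q_unit])

lemma has_Du_rv:
  assumes "has_Du J I a a'" "has_Du J I b b'" "has_Du J I c c'" "has_Du J I d d'"
  shows "has_Du J I (\<lambda>u v. rv (a u v) (b u v) (c u v) (d u v) v)
    (\<lambda>u v. rv (a' u v) (b' u v) (c' u v) (d' u v) v)"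
  using assms unfolding has_Du_def
  by (intro ballI rot_vec_has_vector_derivative_coords) simp_all

lemma has_Dv_rv:
  assumes "has_Dv J I a a'" "has_Dv J I b b'" "has_Dv J I c c'" "has_Dv J I d d'"
  shows "has_Dv J I (\<lambda>u v. rv (a u v) (b u v) (c u v) (d u v) v)
    (\<lambda>u v. rv (a' u v + \<alpha> * c u v) (b' u v + \<beta> * d u v) (c' u v + \<alpha> * a u v) (d' u v + \<beta> * b u v) v)"
  using assms unfolding has_Dv_def
  by (intro ballI rot_vec_has_vector_derivative) simp_all

lemma has_Du_fun_u:
  "(\<And>u. u \<in> J \<Longrightarrow> (h has_vector_derivative h' u) (at u within J)) \<Longrightarrow> has_Du J I (\<lambda>u v. h u) (\<lambda>u v. h' u)"
  by (simp add: has_Du_def)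

lemma has_Dv_fun_u: "has_Dv J I (\<lambda>u v. h u) (\<lambda>u v. 0)"
  by (simp add: has_Dv_def)

lemma has_Du_rv_u:
  assumes "\<And>u. u \<in> J \<Longrightarrow> (a has_vector_derivative a' u) (at u within J)"
    "\<And>u. u \<in> J \<Longrightarrow> (b has_vector_derivative b' u) (at u within J)"
    "\<And>u. u \<in> J \<Longrightarrow> (c has_vector_derivative c' u) (at u within J)"
    "\<And>u. u \<in> J \<Longrightarrow> (d has_vector_derivative d' u) (at u within J)"
  shows "has_Du J I (\<lambda>u v. rv (a u) (b u) (c u) (d u) v) (\<lambda>u v. rv (a' u) (b' u) (c' u) (d' u) v)"
  by (intro has_Du_rv has_Du_fun_u assms)

lemma has_Dv_rv_u:
  "has_Dv J I (\<lambda>u v. rv (a u) (b u) (c u) (d u) v) (\<lambda>u v. rv (\<alpha> * c u) (\<beta> * d u) (\<alpha> * a u) (\<beta> * b u) v)"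
  using has_Dv_rv[OF has_Dv_fun_u has_Dv_fun_u has_Dv_fun_u has_Dv_fun_u, of a b c d] by simp

context
  fixes u v :: real
  assumes u: "u \<in> J" and v: "v \<in> I"
begin

lemma Z_u: "Du J Z u v = rv (f1 u) (g1 u) 0 0 v"
  by (rule Du_eqI[OF J has_Du_rv_u[OF f_deriv g_deriv, of "\<lambda>_. 0" "\<lambda>_. 0" "\<lambda>_. 0" "\<lambda>_. 0"] u v])
     (simp_all add: rot_surf_hyp_eq_rot_vec)

lemma Z_v: "Dv I Z u v = rv 0 0 (\<alpha> * f u) (\<beta> * g u) v"
  using Dv_eqI[OF I has_Dv_rv_u[of f g "\<lambda>_. 0" "\<lambda>_. 0"] u v, of Z]
  by (simp add: rot_surf_hyp_eq_rot_vec)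

lemma first_fundamental_form:
  "fE J I Z u v = E u" "fF J I Z u v = 0" "fG J I Z u v = - L u"
  by (simp_all add: fE_def fF_def fG_def Z_u Z_v ip42_rot_vec E_def L_def power2_eq_square)

lemma tangent_space_iff:
  "t \<in> tangent_space J I Z u v \<longleftrightarrow> (\<exists>x y. t = x *\<^sub>R Du J Z u v + y *\<^sub>R Dv I Z u v)"
proof -
  have "t - x *\<^sub>R a = y *\<^sub>R b \<longleftrightarrow> t = x *\<^sub>R a + y *\<^sub>R b" for x y :: real and a b
    by (auto simp: algebra_simps)
  then show ?thesis
    by (simp add: tangent_space_def span_insert span_breakdown_eq[of t] span_singleton)
qed

lemma normal_space_iff:
  "n \<in> normal_space J I Z u v \<longleftrightarrow> ip42 (Du J Z u v) n = 0 \<and> ip42 (Dv I Z u v) n = 0"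
proof
  assume "n \<in> normal_space J I Z u v"
  then show "ip42 (Du J Z u v) n = 0 \<and> ip42 (Dv I Z u v) n = 0"
    by (simp add: normal_space_def tangent_space_def span_base)
next
  assume "ip42 (Du J Z u v) n = 0 \<and> ip42 (Dv I Z u v) n = 0"
  then show "n \<in> normal_space J I Z u v"
    unfolding normal_space_def
    by (auto simp: tangent_space_iff ip42_add_left ip42_scaleR_left)
qed

text \<open>
  The induced metric is nondegenerate, so a vector that is both tangent and normal is zero and the
  decomposition behind \<^const>\<open>normal_part\<close> is unique.
\<close>

lemma normal_partI:
  assumes "n \<in> normal_space J I Z u v" "w - n \<in> tangent_space J I Z u v"
  shows "normal_part J I Z u v w = n"
  unfolding normal_part_def
proof (rule the_equality)
  fix n' assume n': "n' \<in> normal_space J I Z u v \<and> w - n' \<in> tangent_space J I Z u v"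
  have "(w - n) - (w - n') \<in> tangent_space J I Z u v"
    using assms(2) n' unfolding tangent_space_def by (blast intro: span_diff)
  then obtain x y where xy: "n' - n = x *\<^sub>R Du J Z u v + y *\<^sub>R Dv I Z u v"
    by (auto simp: tangent_space_iff)
  have zero: "ip42 t (n' - n) = 0" if "ip42 t n' = 0" "ip42 t n = 0" for t
    using that by (simp add: ip42_def algebra_simps)
  have "ip42 (Du J Z u v) (n' - n) = 0" "ip42 (Dv I Z u v) (n' - n) = 0"
    using assms(1) n' by (auto simp: normal_space_iff intro!: zero)
  moreover have "n' - n = rv (x * f1 u) (x * g1 u) (y * (\<alpha> * f u)) (y * (\<beta> * g u)) v"
    by (simp add: xy Z_u Z_v rot_vec_scaleR rot_vec_add)
  ultimately have "x * E u = 0" "y * L u = 0"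
    unfolding Z_u Z_v ip42_rot_vec by (simp_all add: ip42_rot_vec E_def L_def power2_eq_square algebra_simps)
  then have "x = 0" "y = 0"
    using E_pos[OF u] L_pos[OF u] by simp_all
  with xy show "n' = n"
    by simp
qed (use assms in simp)

lemma normal_part_normal: "n \<in> normal_space J I Z u v \<Longrightarrow> normal_part J I Z u v n = n"
  by (rule normal_partI) (simp_all add: tangent_space_def span_zero)

lemma normal_vec_in_normal_space: "normal_vec p q u v \<in> normal_space J I Z u v"
proof -
  have "f1 u * (p * P1 u) + g1 u * (p * P2 u) = p * (f1 u * P1 u + g1 u * P2 u)"
    "\<alpha> * f u * (q * Q1 u) + \<beta> * g u * (q * Q2 u) = q * (\<alpha> * f u * Q1 u + \<beta> * g u * Q2 u)"
    by (simp_all add: algebra_simps)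
  then show ?thesis
    unfolding normal_space_iff Z_u Z_v normal_vec_def ip42_rot_vec
    by (simp add: P_orth Q_orth)
qed

lemma normal_part_rot_vec:
  "normal_part J I Z u v (rv a b c d v) = normal_vec (a * P1 u + b * P2 u) (c * Q1 u + d * Q2 u) u v"
    (is "_ = normal_vec ?p ?q u v")
proof (rule normal_partI[OF normal_vec_in_normal_space])
  have P: "a - ?p * P1 u = (a * f1 u + b * g1 u) / E u * f1 u"
    "b - ?p * P2 u = (a * f1 u + b * g1 u) / E u * g1 u"
  proof -
    have "?p * P1 u = a * (P1 u * P1 u) + b * (P1 u * P2 u)"
      "?p * P2 u = a * (P1 u * P2 u) + b * (P2 u * P2 u)"
      by (simp_all add: algebra_simps)
    then show "a - ?p * P1 u = (a * f1 u + b * g1 u) / E u * f1 u"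
      "b - ?p * P2 u = (a * f1 u + b * g1 u) / E u * g1 u"
      using E_pos[OF u] unfolding P_prods[OF u]
      by (simp_all add: field_simps) (simp_all add: E_def algebra_simps power2_eq_square)
  qed
  have Q: "c - ?q * Q1 u = (c * (\<alpha> * f u) + d * (\<beta> * g u)) / L u * (\<alpha> * f u)"
    "d - ?q * Q2 u = (c * (\<alpha> * f u) + d * (\<beta> * g u)) / L u * (\<beta> * g u)"
  proof -
    have "?q * Q1 u = c * (Q1 u * Q1 u) + d * (Q1 u * Q2 u)"
      "?q * Q2 u = c * (Q1 u * Q2 u) + d * (Q2 u * Q2 u)"
      by (simp_all add: algebra_simps)
    then show "c - ?q * Q1 u = (c * (\<alpha> * f u) + d * (\<beta> * g u)) / L u * (\<alpha> * f u)"
      "d - ?q * Q2 u = (c * (\<alpha> * f u) + d * (\<beta> * g u)) / L u * (\<beta> * g u)"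
      using L_pos[OF u] unfolding Q_prods[OF u]
      by (simp_all add: field_simps) (simp_all add: L_def algebra_simps power2_eq_square)
  qed
  have "rv a b c d v - normal_vec ?p ?q u v
    = ((a * f1 u + b * g1 u) / E u) *\<^sub>R Du J Z u v
      + ((c * (\<alpha> * f u) + d * (\<beta> * g u)) / L u) *\<^sub>R Dv I Z u v"
    unfolding normal_vec_def Z_u Z_v rot_vec_diff rot_vec_scaleR rot_vec_add P Q by simp
  then show "rv a b c d v - normal_vec ?p ?q u v \<in> tangent_space J I Z u v"
    unfolding tangent_space_iff by blast
qed

lemma ip42_normal_vec: "ip42 (normal_vec p q u v) (normal_vec p' q' u v) = p * p' - q * q'"
proof -
  have "ip42 (normal_vec p q u v) (normal_vec p' q' u v)
    = p * p' * (P1 u * P1 u + P2 u * P2 u) - q * q' * (Q1 u * Q1 u + Q2 u * Q2 u)"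
    by (simp add: normal_vec_def ip42_rot_vec algebra_simps)
  then show ?thesis
    by (simp add: P_unit[OF u] Q_unit[OF u])
qed

lemma normal_vec_eq_0_iff: "normal_vec p q u v = 0 \<longleftrightarrow> p = 0 \<and> q = 0"
proof
  assume "normal_vec p q u v = 0"
  then have "ip42 (normal_vec p q u v) (normal_vec 1 0 u v) = 0"
    "ip42 (normal_vec p q u v) (normal_vec 0 1 u v) = 0"
    by (simp_all add: ip42_def)
  then show "p = 0 \<and> q = 0"
    by (simp_all add: ip42_normal_vec)
qed (simp add: normal_vec_def rot_vec_0)

lemma normal_expansion:
  assumes "n \<in> normal_space J I Z u v"
  shows "n = normal_vec (ip42 n (normal_vec 1 0 u v)) (- ip42 n (normal_vec 0 1 u v)) u v"
proof -
  obtain a b c d where w: "n = rv a b c d v"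
    by (rule rot_vec_exhaust)
  have "n = normal_vec (a * P1 u + b * P2 u) (c * Q1 u + d * Q2 u) u v"
    using normal_part_normal[OF assms] normal_part_rot_vec unfolding w by simp
  moreover have "ip42 n (normal_vec 1 0 u v) = a * P1 u + b * P2 u"
    "- ip42 n (normal_vec 0 1 u v) = c * Q1 u + d * Q2 u"
    by (simp_all add: w normal_vec_def ip42_rot_vec)
  ultimately show ?thesis
    by simp
qed

end

text \<open>
  In the \<open>u\<close>-direction the frame is parallel: the derivative of either unit normal stays in its own
  Euclidean plane and is orthogonal to it, hence tangent to the surface.
\<close>

lemma nconn_u_normal_vec:
  assumes a: "has_Du J I a a'" and b: "has_Du J I b b'"
    and n: "\<And>u v. u \<in> J \<Longrightarrow> v \<in> I \<Longrightarrow> n u v = normal_vec (a u v) (b u v) u v"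
    and uv: "u \<in> J" "v \<in> I"
  shows "nconn_u J I Z n u v = normal_vec (a' u v) (b' u v) u v"
proof -
  have mult: "has_Du J I (\<lambda>u v. h u v * p u) (\<lambda>u v. h u v * deriv_in J p u + h' u v * p u)"
    if "has_Du J I h h'" "\<And>k. Ck k J p" for h h' p
    using that smooth_deriv_in(1)[OF J that(2)] unfolding has_Du_def
    by (intro ballI bounded_bilinear.has_vector_derivative[OF bounded_bilinear_mult]) simp_all
  have "has_Du J I (\<lambda>u v. normal_vec (a u v) (b u v) u v) (\<lambda>u v.
    rv (a u v * deriv_in J P1 u + a' u v * P1 u) (a u v * deriv_in J P2 u + a' u v * P2 u)
       (b u v * deriv_in J Q1 u + b' u v * Q1 u) (b u v * deriv_in J Q2 u + b' u v * Q2 u) v)"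
    unfolding normal_vec_def by (intro has_Du_rv mult a b Ck_frame)
  from Du_eqI[OF J this uv n] have
    "Du J n u v = rv (a u v * deriv_in J P1 u + a' u v * P1 u) (a u v * deriv_in J P2 u + a' u v * P2 u)
       (b u v * deriv_in J Q1 u + b' u v * Q1 u) (b u v * deriv_in J Q2 u + b' u v * Q2 u) v" .
  moreover have "(x * p' + x' * p) * p + (x * q' + x' * q) * q = x * (p * p' + q * q') + x' * (p * p + q * q)"
    for x x' p p' q q' :: real
    by (simp add: algebra_simps)
  ultimately show ?thesis
    unfolding nconn_u_def
    by (simp add: normal_part_rot_vec[OF uv] P_deriv_orth[OF uv(1)] Q_deriv_orth[OF uv(1)]
        P_unit[OF uv(1)] Q_unit[OF uv(1)])
qed

text \<open>
  In the \<open>v\<close>-direction the rotation of the frame exchanges the two Euclidean planes, so each unit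
  normal is turned towards the other one, at the rate \<open>\<kappa>\<close>.
\<close>

lemma nconn_v_normal_vec:
  assumes a: "has_Dv J I a a'" and b: "has_Dv J I b b'"
    and n: "\<And>u v. u \<in> J \<Longrightarrow> v \<in> I \<Longrightarrow> n u v = normal_vec (a u v) (b u v) u v"
    and uv: "u \<in> J" "v \<in> I"
  shows "nconn_v J I Z n u v = normal_vec (a' u v + \<kappa> u * b u v) (b' u v + \<kappa> u * a u v) u v"
proof -
  have mult: "has_Dv J I (\<lambda>u v. h u v * p u) (\<lambda>u v. h' u v * p u)"
    if "has_Dv J I h h'" for h h' and p :: "real \<Rightarrow> real"
    using that unfolding has_Dv_def
    by (intro ballI bounded_linear.has_vector_derivative[OF bounded_linear_mult_left]) simp_all
  have "has_Dv J I (\<lambda>u v. normal_vec (a u v) (b u v) u v) (\<lambda>u v.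
    rv (a' u v * P1 u + \<alpha> * (b u v * Q1 u)) (a' u v * P2 u + \<beta> * (b u v * Q2 u))
       (b' u v * Q1 u + \<alpha> * (a u v * P1 u)) (b' u v * Q2 u + \<beta> * (a u v * P2 u)) v)"
    unfolding normal_vec_def by (intro has_Dv_rv mult a b)
  from Dv_eqI[OF I this uv n] have "Dv I n u v =
    rv (a' u v * P1 u + \<alpha> * (b u v * Q1 u)) (a' u v * P2 u + \<beta> * (b u v * Q2 u))
       (b' u v * Q1 u + \<alpha> * (a u v * P1 u)) (b' u v * Q2 u + \<beta> * (a u v * P2 u)) v" .
  moreover have "(x' * p + \<alpha> * (y * r)) * p + (x' * q + \<beta> * (y * s)) * q
    = x' * (p * p + q * q) + (\<alpha> * (p * r) + \<beta> * (q * s)) * y" for x' y p q r s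
    by (simp add: algebra_simps)
  moreover have "\<alpha> * (Q1 u * P1 u) + \<beta> * (Q2 u * P2 u) = \<kappa> u"
    by (simp add: \<kappa>_def mult.commute)
  ultimately show ?thesis
    unfolding nconn_v_def
    by (simp add: normal_part_rot_vec[OF uv] P_unit[OF uv(1)] Q_unit[OF uv(1)] \<kappa>_def[symmetric])
qed

text \<open>
  The terms with second derivatives of the coefficients cancel by symmetry, and so do those with
  \<open>\<kappa>\<close> itself; only the derivative of \<open>\<kappa>\<close> survives.
\<close>

lemma normal_curv_tensor_normal_vec:
  assumes a: "has_symmetric_partials J I a au av auv" and b: "has_symmetric_partials J I b bu bv buv"
    and n: "\<And>u v. u \<in> J \<Longrightarrow> v \<in> I \<Longrightarrow> n u v = normal_vec (a u v) (b u v) u v"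
    and uv: "u \<in> J" "v \<in> I"
  shows "normal_curv_tensor J I Z n u v
    = normal_vec (deriv_in J \<kappa> u * b u v) (deriv_in J \<kappa> u * a u v) u v"
proof -
  have a': "has_Du J I a au" "has_Dv J I a av" "has_Dv J I au auv" "has_Du J I av auv"
    and b': "has_Du J I b bu" "has_Dv J I b bv" "has_Dv J I bu buv" "has_Du J I bv buv"
    using a b by (simp_all add: has_symmetric_partials_def)
  have plus_\<kappa>: "has_Du J I (\<lambda>u v. h u v + \<kappa> u * k u v)
      (\<lambda>u v. h' u v + (\<kappa> u * k' u v + deriv_in J \<kappa> u * k u v))"
    if "has_Du J I h h'" "has_Du J I k k'" for h h' k k'
    using that \<kappa>_deriv unfolding has_Du_def
    by (intro ballI has_vector_derivative_add bounded_bilinear.has_vector_derivative[OF bounded_bilinear_mult])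
       simp_all
  have "nconn_u J I Z (nconn_v J I Z n) u v = normal_vec
      (auv u v + (\<kappa> u * bu u v + deriv_in J \<kappa> u * b u v))
      (buv u v + (\<kappa> u * au u v + deriv_in J \<kappa> u * a u v)) u v"
    by (rule nconn_u_normal_vec[OF plus_\<kappa>[OF a'(4) b'(1)] plus_\<kappa>[OF b'(4) a'(1)]
          nconn_v_normal_vec[OF a'(2) b'(2) n] uv])
  moreover have "nconn_v J I Z (nconn_u J I Z n) u v
      = normal_vec (auv u v + \<kappa> u * bu u v) (buv u v + \<kappa> u * au u v) u v"
    by (rule nconn_v_normal_vec[OF a'(3) b'(3) nconn_u_normal_vec[OF a'(1) b'(1) n] uv])
  ultimately show ?thesis
    unfolding normal_curv_tensor_def normal_vec_def by (simp add: rot_vec_diff algebra_simps)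
qed

lemma Ck_on_rv_u:
  assumes "\<And>k. Ck k J a" "\<And>k. Ck k J b" "\<And>k. Ck k J c" "\<And>k. Ck k J d"
  shows "Ck_on k J I (\<lambda>u v. rv (a u) (b u) (c u) (d u) v)"
proof -
  have "Ck_on k J I (\<lambda>u v. ((a u *\<^sub>R rv 1 0 0 0 v + b u *\<^sub>R rv 0 1 0 0 v) + c u *\<^sub>R rv 0 0 1 0 v)
      + d u *\<^sub>R rv 0 0 0 1 v)"
    by (intro Ck_on_add Ck_on_separated Ck_rot_vec assms J I)
  then show ?thesis
    by (simp add: rot_vec_scaleR rot_vec_add)
qed

lemma Ck_on_normal_frame:
  "Ck_on k J I (normal_vec 1 0)" "Ck_on k J I (normal_vec 0 1)"
  using Ck_on_rv_u[of P1 P2 "\<lambda>_. 0" "\<lambda>_. 0"] Ck_on_rv_u[of "\<lambda>_. 0" "\<lambda>_. 0" Q1 Q2]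
  by (simp_all add: normal_vec_def[abs_def] Ck_frame Ck_const)

text \<open>
  For a constant connection form the curvature reduces to the commutator of the partial derivatives
  of the coefficients, which vanishes for every frame of class \<open>C\<^sup>2\<close>. Conversely the frame
  \<open>normal_vec 1 0\<close>, \<open>normal_vec 0 1\<close> reads off \<open>\<kappa>'\<close>.
\<close>

lemma flat_normal_connection_iff:
  "flat_normal_connection J I Z \<longleftrightarrow> (\<forall>u\<in>J. deriv_in J \<kappa> u = 0)"
proof
  assume flat: "flat_normal_connection J I Z"
  have frame: "orthonormal_normal_frame J I Z (normal_vec 1 0) (normal_vec 0 1)"
    unfolding orthonormal_normal_frame_def
    by (simp add: Ck_on_normal_frame normal_vec_in_normal_space ip42_normal_vec)
  have const: "has_symmetric_partials J I (\<lambda>_ _. c :: real) (\<lambda>_ _. 0) (\<lambda>_ _. 0) (\<lambda>_ _. 0)" for c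
    by (simp add: has_symmetric_partials_def has_Du_def has_Dv_def)
  show "\<forall>u\<in>J. deriv_in J \<kappa> u = 0"
  proof
    fix u assume u: "u \<in> J"
    have v: "0 \<in> I" using pi_gt_zero by simp
    have "normal_curv_tensor J I Z (normal_vec 1 0) u 0 = normal_vec 0 (deriv_in J \<kappa> u) u 0"
      using normal_curv_tensor_normal_vec[OF const const refl u v, of 1 0] by simp
    then have "normal_curvature J I Z (normal_vec 1 0) (normal_vec 0 1) u 0 = deriv_in J \<kappa> u / (E u * L u)"
      by (simp add: normal_curvature_def ip42_normal_vec[OF u v] first_fundamental_form[OF u v])
    moreover have "normal_curvature J I Z (normal_vec 1 0) (normal_vec 0 1) u 0 = 0"
      using flat frame u v unfolding flat_normal_connection_def by blast
    ultimately show "deriv_in J \<kappa> u = 0"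
      using E_pos[OF u] L_pos[OF u] by simp
  qed
next
  assume \<kappa>: "\<forall>u\<in>J. deriv_in J \<kappa> u = 0"
  show "flat_normal_connection J I Z"
    unfolding flat_normal_connection_def
  proof (intro allI impI ballI)
    fix n1 n2 u v assume frame: "orthonormal_normal_frame J I Z n1 n2" and uv: "u \<in> J" "v \<in> I"
    have "Ck_on 2 J I n1"
      using frame by (simp add: orthonormal_normal_frame_def)
    then have n1: "has_symmetric_partials J I n1 (Du J n1) (Dv I n1) (Dv I (Du J n1))"
      by (rule Ck_on_symmetric_partials[OF J I])
    note N = Ck_on_symmetric_partials[OF J I Ck_on_normal_frame(1)]
      Ck_on_symmetric_partials[OF J I Ck_on_normal_frame(2)]
    have neg: "bounded_bilinear (\<lambda>x y. - ip42 x y)"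
      by (rule bounded_bilinear_minus_ip42)
    have "n1 u v = normal_vec (ip42 (n1 u v) (normal_vec 1 0 u v)) (- ip42 (n1 u v) (normal_vec 0 1 u v)) u v"
      if "u \<in> J" "v \<in> I" for u v
      using frame that by (intro normal_expansion) (simp_all add: orthonormal_normal_frame_def)
    from normal_curv_tensor_normal_vec[OF has_symmetric_partials_bilinear[OF bounded_bilinear_ip42 n1 N(1)]
        has_symmetric_partials_bilinear[OF neg n1 N(2)] this uv]
    have "normal_curv_tensor J I Z n1 u v = 0"
      using \<kappa> uv(1) by (simp add: normal_vec_eq_0_iff[OF uv])
    then show "normal_curvature J I Z n1 n2 u v = 0"
      by (simp add: normal_curvature_def ip42_def)
  qed
qed

definition "\<eta> u = (L u * (f2 u * P1 u + g2 u * P2 u) - E u * (\<alpha>\<^sup>2 * f u * P1 u + \<beta>\<^sup>2 * g u * P2 u)) / (2 * E u * L u)"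

lemma mean_curvature_vector_eq:
  assumes uv: "u \<in> J" "v \<in> I"
  shows "mean_curvature_vector J I Z u v = normal_vec (\<eta> u) 0 u v"
proof -
  have uu: "Du J (Du J Z) u v = rv (f2 u) (g2 u) 0 0 v"
    by (rule Du_eqI[OF J has_Du_rv_u[OF f1_deriv g1_deriv, of "\<lambda>_. 0" "\<lambda>_. 0" "\<lambda>_. 0" "\<lambda>_. 0"] uv])
       (simp_all add: Z_u)
  have vv: "Dv I (Dv I Z) u v = rv (\<alpha> * (\<alpha> * f u)) (\<beta> * (\<beta> * g u)) 0 0 v"
    using Dv_eqI[OF I has_Dv_rv_u[of "\<lambda>_. 0" "\<lambda>_. 0" "\<lambda>u. \<alpha> * f u" "\<lambda>u. \<beta> * g u"] uv Z_v]
    by simp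
  define s t where "s = f2 u * P1 u + g2 u * P2 u" and "t = \<alpha>\<^sup>2 * f u * P1 u + \<beta>\<^sup>2 * g u * P2 u"
  have st: "sff_uu J I Z u v = normal_vec s 0 u v" "sff_vv J I Z u v = normal_vec t 0 u v"
    by (simp_all add: sff_uu_def sff_vv_def uu vv normal_part_rot_vec[OF uv] s_def t_def
        power2_eq_square mult.assoc)
  have scale: "k *\<^sub>R normal_vec p 0 u v = normal_vec (k * p) 0 u v" for k p
    by (simp add: normal_vec_def rot_vec_scaleR mult.assoc)
  have add: "normal_vec p 0 u v + normal_vec p' 0 u v = normal_vec (p + p') 0 u v" for p p'
    by (simp add: normal_vec_def rot_vec_add algebra_simps)
  have "mean_curvature_vector J I Z u v
      = normal_vec (1 / 2 * (1 / (E u * - L u) * (- L u * s + E u * t))) 0 u v"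
    unfolding mean_curvature_vector_def first_fundamental_form[OF uv] st
    by (simp only: scale add mult_zero_right scaleR_zero_left diff_zero power_zero_numeral)
  also have "1 / 2 * (1 / (E u * - L u) * (- L u * s + E u * t)) = (L u * s - E u * t) / (2 * E u * L u)"
    using E_pos[OF uv(1)] L_pos[OF uv(1)] by (simp add: field_simps)
  also have "\<dots> = \<eta> u"
    by (simp add: \<eta>_def s_def t_def)
  finally show ?thesis .
qed

section \<open>The meridian equations\<close>

definition "M u = f u * f1 u + g u * g1 u"
definition "\<phi> u = M u / (sqrt (E u) * sqrt (L u))"

text \<open>
  For the unit tangent vectors \<open>x\<close>, \<open>y\<close> along \<open>z\<^sub>u\<close>, \<open>z\<^sub>v\<close>, the functions \<open>D\<close>, \<open>T\<close> and \<open>W\<close> are nonzero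
  multiples of the components of \<open>\<sigma>(x, x)\<close>, \<open>\<sigma>(y, y)\<close> and \<open>\<sigma>(x, y)\<close>. As for the meridian, \<open>D = 0\<close>
  where its curvature vanishes and \<open>W = 0\<close> where position and velocity are parallel.
\<close>

definition "W u = f u * g1 u - g u * f1 u"
definition "D u = f2 u * g1 u - g2 u * f1 u"
definition "T u = \<alpha>\<^sup>2 * f u * g1 u - \<beta>\<^sup>2 * g u * f1 u"

lemmas real_derivs =
  f_deriv[folded has_real_derivative_iff_has_vector_derivative]
  g_deriv[folded has_real_derivative_iff_has_vector_derivative]
  f1_deriv[folded has_real_derivative_iff_has_vector_derivative]
  g1_deriv[folded has_real_derivative_iff_has_vector_derivative]

lemma \<kappa>_eq: "\<kappa> u = \<alpha> * \<beta> * \<phi> u"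
proof -
  define x y where "x = 1 / sqrt (E u)" and "y = 1 / sqrt (L u)"
  have "\<phi> u = M u * (x * y)"
    by (simp add: \<phi>_def x_def y_def)
  then show ?thesis
    unfolding \<kappa>_def P1_def P2_def Q1_def Q2_def x_def[symmetric] y_def[symmetric]
    by (simp add: M_def algebra_simps)
qed

lemma \<eta>_eq: "\<eta> u = (L u * D u - E u * T u) / (2 * E u * L u * sqrt (E u))"
proof -
  define x where "x = 1 / sqrt (E u)"
  have "L u * (f2 u * P1 u + g2 u * P2 u) - E u * (\<alpha>\<^sup>2 * f u * P1 u + \<beta>\<^sup>2 * g u * P2 u)
      = (L u * D u - E u * T u) * x"
    unfolding P1_def P2_def x_def[symmetric] by (simp add: D_def T_def algebra_simps)
  then show ?thesis
    by (simp add: \<eta>_def x_def)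
qed

lemma deriv_unique:
  assumes "u \<in> J" "(h has_real_derivative h') (at u within J)" "(h has_real_derivative h'') (at u within J)"
  shows "h' = h''"
  using proper_interval_vector_derivative[OF J assms(1)] assms(2,3)
  unfolding has_real_derivative_iff_has_vector_derivative by metis

lemma deriv_0_if_constant_on:
  assumes "\<And>u. u \<in> J \<Longrightarrow> h u = c" "u \<in> J" "(h has_real_derivative h') (at u within J)"
  shows "h' = 0"
proof (rule deriv_unique[OF assms(2,3)])
  show "(h has_real_derivative 0) (at u within J)"
    unfolding has_real_derivative_iff_has_vector_derivative
    by (rule has_vector_derivative_eq_on[OF has_vector_derivative_const[of c] assms(2,1)])
qed

lemma constant_on_if_deriv_0:
  assumes "\<And>u. u \<in> J \<Longrightarrow> (h has_real_derivative 0) (at u within J)"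
  obtains c where "\<And>u. u \<in> J \<Longrightarrow> h u = c"
proof -
  have "convex J"
    using J by (simp add: proper_interval_def is_interval_convex_1)
  from has_field_derivative_zero_constant[OF this assms] show ?thesis
    using that by blast
qed

lemma flat_iff_\<phi>_constant: "flat_normal_connection J I Z \<longleftrightarrow> (\<exists>C. \<forall>u\<in>J. \<phi> u = C)"
proof
  assume "flat_normal_connection J I Z"
  then have "(\<kappa> has_real_derivative 0) (at u within J)" if "u \<in> J" for u
    using \<kappa>_deriv[OF that] that
    by (simp add: flat_normal_connection_iff has_real_derivative_iff_has_vector_derivative)
  then obtain c where "\<And>u. u \<in> J \<Longrightarrow> \<kappa> u = c"
    using constant_on_if_deriv_0 by blast
  then have "\<forall>u\<in>J. \<phi> u = c / (\<alpha> * \<beta>)"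
    using \<alpha>_pos \<beta>_pos by (auto simp: \<kappa>_eq field_simps)
  then show "\<exists>C. \<forall>u\<in>J. \<phi> u = C" ..
next
  assume "\<exists>C. \<forall>u\<in>J. \<phi> u = C"
  then obtain C where "\<And>u. u \<in> J \<Longrightarrow> \<kappa> u = \<alpha> * \<beta> * C"
    by (auto simp: \<kappa>_eq)
  then show "flat_normal_connection J I Z"
    unfolding flat_normal_connection_iff
    using deriv_0_if_constant_on[OF _ _ \<kappa>_deriv[folded has_real_derivative_iff_has_vector_derivative]]
    by blast
qed

lemma M_deriv:
  assumes "u \<in> J"
  shows "(M has_real_derivative E u + (f u * f2 u + g u * g2 u)) (at u within J)"
  unfolding M_def[abs_def] using real_derivs[OF assms]
  by (auto intro!: derivative_eq_intros simp: E_def power2_eq_square algebra_simps)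

text \<open>
  This is the Ricci equation: the curvature \<open>\<phi>'\<close> vanishes exactly where the shape operators commute,
  that is where \<open>\<sigma>(x, y)\<close> or \<open>\<sigma>(x, x) + \<sigma>(y, y)\<close> vanishes. (For the mean curvature, the signature
  turns the sum into the difference \<open>\<sigma>(x, x) - \<sigma>(y, y)\<close>.)
\<close>

lemma \<phi>_deriv:
  assumes u: "u \<in> J"
  shows "(\<phi> has_real_derivative W u * (L u * D u + E u * T u) / (E u * L u * (sqrt (E u) * sqrt (L u))))
    (at u within J)"
proof -
  define a b where "a = sqrt (E u)" and "b = sqrt (L u)"
  have ab: "a > 0" "b > 0" "E u = a\<^sup>2" "L u = b\<^sup>2"
    using E_pos[OF u] L_pos[OF u] by (simp_all add: a_def b_def)
  note d = real_derivs[OF u]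
  define N K M' where "N = f1 u * f2 u + g1 u * g2 u"
    and "K = \<alpha>\<^sup>2 * (f u * f1 u) + \<beta>\<^sup>2 * (g u * g1 u)"
    and "M' = E u + (f u * f2 u + g u * g2 u)"
  have E': "(E has_real_derivative 2 * N) (at u within J)"
    unfolding E_def[abs_def] N_def using d by (auto intro!: derivative_eq_intros)
  have L': "(L has_real_derivative 2 * K) (at u within J)"
    unfolding L_def[abs_def] K_def using d by (auto intro!: derivative_eq_intros simp: algebra_simps)
  have M': "(M has_real_derivative M') (at u within J)"
    unfolding M'_def by (rule M_deriv[OF u])
  have sE: "((\<lambda>u. sqrt (E u)) has_real_derivative N / a) (at u within J)"
    by (rule DERIV_cong[OF DERIV_chain'[OF E' DERIV_real_sqrt[OF E_pos[OF u]]]]) (simp add: a_def inverse_eq_divide)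
  have sL: "((\<lambda>u. sqrt (L u)) has_real_derivative K / b) (at u within J)"
    by (rule DERIV_cong[OF DERIV_chain'[OF L' DERIV_real_sqrt[OF L_pos[OF u]]]]) (simp add: b_def inverse_eq_divide)
  have "sqrt (E u) * sqrt (L u) \<noteq> 0"
    using ab(1,2) by (simp add: a_def b_def)
  from DERIV_divide[OF M' DERIV_mult[OF sE sL] this]
  have "(\<phi> has_real_derivative (M' * (a * b) - M u * (N / a * b + K / b * a)) / (a * b * (a * b)))
      (at u within J)"
    unfolding \<phi>_def[abs_def] a_def[symmetric] b_def[symmetric] .
  also have "(M' * (a * b) - M u * (N / a * b + K / b * a)) / (a * b * (a * b))
      = (a\<^sup>2 * b\<^sup>2 * M' - M u * (b\<^sup>2 * N + a\<^sup>2 * K)) / (a\<^sup>2 * b\<^sup>2 * (a * b))"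
  proof -
    have *: "a * b * (M' * (a * b) - M u * (N / a * b + K / b * a))
        = a\<^sup>2 * b\<^sup>2 * M' - M u * (b\<^sup>2 * N + a\<^sup>2 * K)"
      using ab(1,2) by (simp add: field_simps power2_eq_square)
    then show ?thesis
      unfolding *[symmetric] using ab(1,2) by (simp add: power2_eq_square)
  qed
  also have "\<dots> = (E u * L u * M' - M u * (L u * N + E u * K)) / (E u * L u * (a * b))"
    by (simp only: ab(3,4))
  also have "E u * L u * M' - M u * (L u * N + E u * K) = W u * (L u * D u + E u * T u)"
  proof -
    have 1: "E u * (f u * f2 u + g u * g2 u) - M u * N = W u * D u"
      unfolding E_def M_def N_def W_def D_def by algebra
    have 2: "E u * L u - M u * K = W u * T u"
      unfolding E_def M_def K_def L_def W_def T_def by algebra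
    have "E u * L u * M' - M u * (L u * N + E u * K)
      = L u * (E u * (f u * f2 u + g u * g2 u) - M u * N) + E u * (E u * L u - M u * K)"
      unfolding M'_def by algebra
    then show ?thesis
      unfolding 1 2 by algebra
  qed
  finally show ?thesis
    by (simp add: a_def b_def)
qed

lemma \<phi>_constant_imp:
  assumes "\<And>u. u \<in> J \<Longrightarrow> \<phi> u = C" "u \<in> J"
  shows "W u * (L u * D u + E u * T u) = 0"
  using deriv_0_if_constant_on[OF assms \<phi>_deriv[OF assms(2)]] E_pos[OF assms(2)] L_pos[OF assms(2)]
  by simp

lemma \<phi>_constant_if_W_0:
  assumes "\<And>u. u \<in> J \<Longrightarrow> W u = 0"
  obtains C where "\<And>u. u \<in> J \<Longrightarrow> \<phi> u = C"
  using constant_on_if_deriv_0[of \<phi>] \<phi>_deriv assms by (metis div_0 mult_zero_left)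

lemma parallel_imp:
  assumes "parallel_normal_field J I Z (mean_curvature_vector J I Z)" "u \<in> J"
  shows "\<phi> u = 0 \<or> \<eta> u = 0"
proof -
  have v: "0 \<in> I" using pi_gt_zero by simp
  have "nconn_v J I Z (mean_curvature_vector J I Z) u 0 = normal_vec (0 + \<kappa> u * 0) (0 + \<kappa> u * \<eta> u) u 0"
    by (rule nconn_v_normal_vec[OF has_Dv_fun_u has_Dv_fun_u mean_curvature_vector_eq assms(2) v])
  moreover have "nconn_v J I Z (mean_curvature_vector J I Z) u 0 = 0"
    using assms v unfolding parallel_normal_field_def by blast
  ultimately have "\<kappa> u * \<eta> u = 0"
    by (simp add: normal_vec_eq_0_iff[OF assms(2) v])
  then show ?thesis
    using \<alpha>_pos \<beta>_pos by (simp add: \<kappa>_eq)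
qed

text \<open>
  If position and velocity are orthogonal, the meridian lies on a circle \<open>f\<^sup>2 + g\<^sup>2 = \<rho>\<close>, hence the
  surface on the pseudosphere \<open>\<langle>z, z\<rangle> = \<rho>\<close>. Its mean curvature vector is then \<open>- Z / \<rho>\<close>, and the
  derivatives of this field are tangent to the surface.
\<close>

lemma parallel_if_M_0:
  assumes M0: "\<And>u. u \<in> J \<Longrightarrow> M u = 0"
  shows "parallel_normal_field J I Z (mean_curvature_vector J I Z)"
proof -
  have "((\<lambda>u. (f u)\<^sup>2 + (g u)\<^sup>2) has_real_derivative 0) (at u within J)" if "u \<in> J" for u
    using real_derivs[OF that] M0[OF that]
    by (auto intro!: derivative_eq_intros simp: M_def algebra_simps)
  then obtain \<rho> where \<rho>: "\<And>u. u \<in> J \<Longrightarrow> (f u)\<^sup>2 + (g u)\<^sup>2 = \<rho>"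
    using constant_on_if_deriv_0 by blast
  have coeffs: "\<eta> u * P1 u = - 1 / \<rho> * f u" "\<eta> u * P2 u = - 1 / \<rho> * g u" if u: "u \<in> J" for u
  proof -
    have EL: "E u > 0" "L u > 0" using E_pos[OF u] L_pos[OF u] .
    have "\<rho> \<noteq> 0"
    proof
      assume "\<rho> = 0"
      with \<rho>[OF u] have "f u = 0" "g u = 0"
        by (simp_all add: sum_power2_eq_zero_iff)
      with EL(2) show False by (simp add: L_def)
    qed
    \<comment> \<open>the angular velocity on the circle\<close>
    define k where "k = W u / \<rho>"
    have "\<rho> * f1 u = - W u * g u + f u * M u" "\<rho> * g1 u = W u * f u + g u * M u"
      unfolding \<rho>[OF u, symmetric] W_def M_def by (simp_all add: algebra_simps power2_eq_square)
    then have f1: "f1 u = - k * g u" and g1: "g1 u = k * f u"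
      using M0[OF u] \<open>\<rho> \<noteq> 0\<close> by (simp_all add: k_def field_simps)
    have E: "E u = k\<^sup>2 * \<rho>"
      unfolding \<rho>[OF u, symmetric] by (simp add: E_def f1 g1 power_mult_distrib algebra_simps)
    then have "k \<noteq> 0" using EL(1) by auto
    have acc: "f u * f2 u + g u * g2 u = - E u"
      using deriv_0_if_constant_on[OF M0 u M_deriv[OF u]] by simp
    have "D u = k * (f u * f2 u + g u * g2 u)"
      by (simp add: D_def f1 g1 algebra_simps)
    then have D: "D u = - k * E u"
      using acc by simp
    have T: "T u = k * L u"
      by (simp add: T_def L_def f1 g1 algebra_simps power2_eq_square)
    have LD: "L u * D u - E u * T u = - k * (2 * E u * L u)"
      by (simp add: D T)
    have \<eta>: "\<eta> u = - k / sqrt (E u)"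
      unfolding \<eta>_eq LD using EL by simp
    have "\<eta> u * P1 u = - k * g1 u / E u" "\<eta> u * P2 u = k * f1 u / E u"
      using EL by (simp_all add: \<eta> P1_def P2_def)
    then show "\<eta> u * P1 u = - 1 / \<rho> * f u" "\<eta> u * P2 u = - 1 / \<rho> * g u"
      using \<open>k \<noteq> 0\<close> \<open>\<rho> \<noteq> 0\<close> by (simp_all add: f1 g1 E field_simps power2_eq_square)
  qed
  have H: "mean_curvature_vector J I Z u v = rv (- 1 / \<rho> * f u) (- 1 / \<rho> * g u) 0 0 v"
    if "u \<in> J" "v \<in> I" for u v
    unfolding mean_curvature_vector_eq[OF that] normal_vec_def coeffs[OF that(1)] by simp
  show ?thesis
    unfolding parallel_normal_field_def
  proof (intro ballI conjI)
    fix u v assume uv: "u \<in> J" "v \<in> I"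
    have f': "((\<lambda>u. - 1 / \<rho> * f u) has_vector_derivative - 1 / \<rho> * f1 u) (at u within J)"
      and g': "((\<lambda>u. - 1 / \<rho> * g u) has_vector_derivative - 1 / \<rho> * g1 u) (at u within J)"
      if "u \<in> J" for u
      by (rule bounded_linear.has_vector_derivative[OF bounded_linear_mult_right f_deriv[OF that]]
          bounded_linear.has_vector_derivative[OF bounded_linear_mult_right g_deriv[OF that]])+
    have "Du J (mean_curvature_vector J I Z) u v = rv (- 1 / \<rho> * f1 u) (- 1 / \<rho> * g1 u) 0 0 v"
      by (rule Du_eqI[OF J has_Du_rv_u[OF f' g', of "\<lambda>_. 0" "\<lambda>_. 0" "\<lambda>_. 0" "\<lambda>_. 0"] uv H]) simp_all
    moreover have "- 1 / \<rho> * f1 u * P1 u + - 1 / \<rho> * g1 u * P2 u = - 1 / \<rho> * (f1 u * P1 u + g1 u * P2 u)"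
      by (simp only: distrib_left mult.assoc)
    ultimately show "nconn_u J I Z (mean_curvature_vector J I Z) u v = 0"
      unfolding nconn_u_def
      by (simp add: normal_part_rot_vec[OF uv] P_orth normal_vec_def rot_vec_0)
    have "nconn_v J I Z (mean_curvature_vector J I Z) u v = normal_vec (0 + \<kappa> u * 0) (0 + \<kappa> u * \<eta> u) u v"
      by (rule nconn_v_normal_vec[OF has_Dv_fun_u has_Dv_fun_u mean_curvature_vector_eq uv])
    then show "nconn_v J I Z (mean_curvature_vector J I Z) u v = 0"
      by (simp add: \<kappa>_eq \<phi>_def M0[OF uv(1)] normal_vec_eq_0_iff[OF uv])
  qed
qed

text \<open>
  A point with \<open>W \<noteq> 0\<close> would have a neighbourhood on which the second fundamental form has only its
  mixed component, so that \<open>D = T = 0\<close>. Differentiating \<open>T = 0\<close> along the meridian, which is straight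
  by \<open>D = 0\<close>, gives \<open>(\<alpha>\<^sup>2 - \<beta>\<^sup>2) f' g' = 0\<close>. Together with \<open>T = 0\<close> this forces \<open>W = 0\<close>.
\<close>

lemma minimal_flat_imp_W_0:
  assumes WDT: "\<And>u. u \<in> J \<Longrightarrow> W u * (L u * D u + E u * T u) = 0"
    and \<eta>0: "\<And>u. u \<in> J \<Longrightarrow> L u * D u = E u * T u"
    and u: "u \<in> J"
  shows "W u = 0"
proof (rule ccontr)
  assume W: "W u \<noteq> 0"
  have DT: "D x = 0 \<and> T x = 0" if "x \<in> J" "W x \<noteq> 0" for x
    using WDT[OF that(1)] \<eta>0[OF that(1)] that(2) E_pos[OF that(1)] L_pos[OF that(1)] by auto
  have d: "(f has_real_derivative f1 u) (at u within J)" "(g has_real_derivative g1 u) (at u within J)"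
    "(f1 has_real_derivative f2 u) (at u within J)" "(g1 has_real_derivative g2 u) (at u within J)"
    using real_derivs[OF u] .
  have "continuous (at u within J) W"
    unfolding W_def[abs_def] using d[THEN DERIV_continuous] by (intro continuous_intros)
  then obtain \<delta> where \<delta>: "\<delta> > 0" "\<And>x. x \<in> J \<Longrightarrow> dist x u < \<delta> \<Longrightarrow> W x \<noteq> 0"
    using W continuous_within_avoid[of u J W 0] by (metis dist_commute)
  have "(T has_real_derivative \<alpha>\<^sup>2 * (f1 u * g1 u + f u * g2 u) - \<beta>\<^sup>2 * (g1 u * f1 u + g u * f2 u)) (at u within J)"
    unfolding T_def[abs_def] using d by (auto intro!: derivative_eq_intros simp: algebra_simps)
  then have "((\<lambda>_. 0) has_real_derivative \<alpha>\<^sup>2 * (f1 u * g1 u + f u * g2 u) - \<beta>\<^sup>2 * (g1 u * f1 u + g u * f2 u))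
      (at u within J)"
    unfolding has_real_derivative_iff_has_vector_derivative
    by (rule has_vector_derivative_transform_within[OF _ \<delta>(1) u]) (use DT \<delta>(2) in blast)
  from deriv_0_if_constant_on[OF refl u this]
  have T': "\<alpha>\<^sup>2 * (f1 u * g1 u + f u * g2 u) - \<beta>\<^sup>2 * (g1 u * f1 u + g u * f2 u) = 0" .
  \<comment> \<open>by \<open>D = 0\<close> the acceleration is \<open>N / E\<close> times the velocity\<close>
  define N where "N = f1 u * f2 u + g1 u * g2 u"
  have "E u * f2 u = f1 u * N + g1 u * D u" "E u * g2 u = g1 u * N - f1 u * D u"
    unfolding E_def N_def D_def by (simp_all add: algebra_simps power2_eq_square)
  then have acc: "E u * f2 u = f1 u * N" "E u * g2 u = g1 u * N"
    using DT[OF u W] by simp_all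
  have "E u * (\<alpha>\<^sup>2 * (f1 u * g1 u + f u * g2 u) - \<beta>\<^sup>2 * (g1 u * f1 u + g u * f2 u))
      = E u * ((\<alpha>\<^sup>2 - \<beta>\<^sup>2) * (f1 u * g1 u)) + (\<alpha>\<^sup>2 * f u * (E u * g2 u) - \<beta>\<^sup>2 * g u * (E u * f2 u))"
    by (simp add: algebra_simps)
  also have "\<dots> = E u * ((\<alpha>\<^sup>2 - \<beta>\<^sup>2) * (f1 u * g1 u)) + T u * N"
    unfolding acc T_def by (simp add: algebra_simps)
  finally have "(\<alpha>\<^sup>2 - \<beta>\<^sup>2) * (f1 u * g1 u) = 0"
    using T' DT[OF u W] E_pos[OF u] by simp
  then consider "\<alpha>\<^sup>2 = \<beta>\<^sup>2" | "f1 u = 0" | "g1 u = 0"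
    by auto
  then show False
  proof cases
    case 1
    then have "T u = \<alpha>\<^sup>2 * W u"
      by (simp add: T_def W_def algebra_simps)
    then show False using DT[OF u W] W \<alpha>_pos by simp
  next
    case 2
    then show False using DT[OF u W] W \<alpha>_pos by (simp add: T_def W_def)
  next
    case 3
    then show False using DT[OF u W] W \<beta>_pos by (simp add: T_def W_def)
  qed
qed

text \<open>
  A meridian with \<open>W = 0\<close> is a straight line through the origin in a direction \<open>(c1, c2)\<close>. If in
  addition \<open>H = 0\<close>, then \<open>T = 0\<close>, which leaves only \<open>\<alpha> = \<beta>\<close> or one of the coordinate axes. In each
  case the surface stays in the plane of \<open>(c1, c2, 0, 0)\<close> and \<open>(0, 0, c1, c2)\<close>.
\<close>

lemma plane_if_W_0_minimal:
  assumes W0: "\<And>u. u \<in> J \<Longrightarrow> W u = 0"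
    and \<eta>0: "\<And>u. u \<in> J \<Longrightarrow> L u * D u = E u * T u"
  shows "contains_open_part_of_plane J I Z"
proof -
  define \<rho> where "\<rho> u = sqrt ((f u)\<^sup>2 + (g u)\<^sup>2)" for u
  have pos: "(f u)\<^sup>2 + (g u)\<^sup>2 > 0" if "u \<in> J" for u
  proof (rule ccontr)
    assume "\<not> ?thesis"
    then have "f u = 0" "g u = 0"
      using sum_power2_gt_zero_iff by blast+
    then show False using L_pos[OF that] by (simp add: L_def)
  qed
  have \<rho>: "\<rho> u > 0" "\<rho> u * \<rho> u = f u * f u + g u * g u" if "u \<in> J" for u
    using pos[OF that] by (simp_all add: \<rho>_def power2_eq_square)
  have \<rho>': "(\<rho> has_real_derivative (f u * f1 u + g u * g1 u) / \<rho> u) (at u within J)" if u: "u \<in> J" for u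
  proof -
    have "((\<lambda>u. (f u)\<^sup>2 + (g u)\<^sup>2) has_real_derivative 2 * (f u * f1 u + g u * g1 u)) (at u within J)"
      using real_derivs[OF u] by (auto intro!: derivative_eq_intros)
    from DERIV_chain'[OF this DERIV_real_sqrt[OF pos[OF u]]] show ?thesis
      unfolding \<rho>_def[abs_def] by (rule DERIV_cong) (simp add: inverse_eq_divide del: distrib_left_numeral)
  qed
  have quot: "((\<lambda>u. h u / \<rho> u) has_real_derivative 0) (at u within J)"
    if u: "u \<in> J" and h: "(h has_real_derivative h') (at u within J)"
      and 0: "h' * (f u * f u + g u * g u) = h u * (f u * f1 u + g u * g1 u)" for h h' u
  proof -
    have "((\<lambda>u. h u / \<rho> u) has_real_derivative (h' * \<rho> u - h u * ((f u * f1 u + g u * g1 u) / \<rho> u)) / (\<rho> u * \<rho> u))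
        (at u within J)"
      using \<rho>(1)[OF u] by (intro DERIV_divide h \<rho>'[OF u]) simp
    moreover have "h' * \<rho> u - h u * ((f u * f1 u + g u * g1 u) / \<rho> u)
        = (h' * (\<rho> u * \<rho> u) - h u * (f u * f1 u + g u * g1 u)) / \<rho> u"
      using \<rho>(1)[OF u] by (simp add: field_simps)
    ultimately show ?thesis
      unfolding \<rho>(2)[OF u] 0 by simp
  qed
  have "((\<lambda>u. f u / \<rho> u) has_real_derivative 0) (at u within J)" if "u \<in> J" for u
  proof (rule quot[OF that real_derivs(1)[OF that]])
    have "f1 u * (f u * f u + g u * g u) = f u * (f u * f1 u + g u * g1 u) - g u * W u"
      by (simp add: W_def algebra_simps)
    then show "f1 u * (f u * f u + g u * g u) = f u * (f u * f1 u + g u * g1 u)"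
      by (simp add: W0[OF that])
  qed
  then obtain c1 where "\<And>u. u \<in> J \<Longrightarrow> f u / \<rho> u = c1"
    using constant_on_if_deriv_0 by blast
  then have f: "f u = c1 * \<rho> u" if "u \<in> J" for u
    using \<rho>(1)[OF that] that by (metis less_irrefl nonzero_divide_eq_eq)
  have "((\<lambda>u. g u / \<rho> u) has_real_derivative 0) (at u within J)" if "u \<in> J" for u
  proof (rule quot[OF that real_derivs(2)[OF that]])
    have "g1 u * (f u * f u + g u * g u) = g u * (f u * f1 u + g u * g1 u) + f u * W u"
      by (simp add: W_def algebra_simps)
    then show "g1 u * (f u * f u + g u * g u) = g u * (f u * f1 u + g u * g1 u)"
      by (simp add: W0[OF that])
  qed
  then obtain c2 where "\<And>u. u \<in> J \<Longrightarrow> g u / \<rho> u = c2"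
    using constant_on_if_deriv_0 by blast
  then have g: "g u = c2 * \<rho> u" if "u \<in> J" for u
    using \<rho>(1)[OF that] that by (metis less_irrefl nonzero_divide_eq_eq)
  obtain u0 where u0: "u0 \<in> J"
    using J interior_subset unfolding proper_interval_def by blast
  have c: "c1 \<noteq> 0 \<or> c2 \<noteq> 0"
    using pos[OF u0] f[OF u0] g[OF u0] by auto
  have cases: "\<alpha> = \<beta> \<or> c1 = 0 \<or> c2 = 0"
  proof (rule ccontr)
    assume "\<not> ?thesis"
    then have ne: "\<alpha> \<noteq> \<beta>" "c1 \<noteq> 0" "c2 \<noteq> 0" by auto
    have "(W has_real_derivative f u0 * g2 u0 - g u0 * f2 u0) (at u0 within J)"
      unfolding W_def[abs_def] using real_derivs[OF u0]
      by (auto intro!: derivative_eq_intros simp: algebra_simps)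
    from deriv_0_if_constant_on[OF W0 u0 this] have "\<rho> u0 * (c1 * g2 u0 - c2 * f2 u0) = 0"
      by (simp add: f[OF u0] g[OF u0] algebra_simps)
    then have acc: "c1 * g2 u0 = c2 * f2 u0"
      using \<rho>(1)[OF u0] by simp
    have "\<rho> u0 * (c1 * g1 u0 - c2 * f1 u0) = 0"
      using W0[OF u0] by (simp add: W_def f[OF u0] g[OF u0] algebra_simps)
    then have vel: "c1 * g1 u0 = c2 * f1 u0"
      using \<rho>(1)[OF u0] by simp
    have "c1 * D u0 = f2 u0 * (c1 * g1 u0) - (c1 * g2 u0) * f1 u0"
      by (simp add: D_def algebra_simps)
    then have "D u0 = 0"
      unfolding acc vel using ne by (simp add: algebra_simps)
    then have "T u0 = 0"
      using \<eta>0[OF u0] E_pos[OF u0] by simp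
    moreover have "T u0 = \<rho> u0 * (\<alpha>\<^sup>2 * (c1 * g1 u0) - \<beta>\<^sup>2 * (c2 * f1 u0))"
      by (simp add: T_def f[OF u0] g[OF u0] algebra_simps)
    ultimately have "(\<alpha>\<^sup>2 - \<beta>\<^sup>2) * (c2 * f1 u0) = 0"
      using \<rho>(1)[OF u0] vel by (simp add: algebra_simps)
    moreover have "\<alpha>\<^sup>2 \<noteq> \<beta>\<^sup>2"
      using ne \<alpha>_pos \<beta>_pos by (simp add: power2_eq_iff)
    ultimately have "f1 u0 = 0" "g1 u0 = 0"
      using ne vel by auto
    then show False using E_pos[OF u0] by (simp add: E_def)
  qed
  define p q :: "real^4" where "p = vector [c1, c2, 0, 0]" and "q = vector [0, 0, c1, c2]"
  \<comment> \<open>only this rate matters: the coordinates with the other rate vanish unless the rates agree\<close>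
  define \<omega> where "\<omega> = (if c1 = 0 then \<beta> else \<alpha>)"
  have Z: "Z u v = (\<rho> u * cosh (\<omega> * v)) *\<^sub>R p + (\<rho> u * sinh (\<omega> * v)) *\<^sub>R q" if "u \<in> J" for u v
    using cases by (auto simp: rot_surf_hyp_def p_def q_def \<omega>_def vec_eq_iff forall_4 f[OF that] g[OF that])
  have in_span: "Z u v \<in> span {p, q}" if "u \<in> J" for u v
    unfolding Z[OF that] by (intro span_add span_scale span_base) simp_all
  have sub: "(\<lambda>(u, v). Z u v) ` (J \<times> I) \<subseteq> span {p, q}"
  proof (rule image_subsetI)
    fix x assume "x \<in> J \<times> I"
    then have "fst x \<in> J" by (simp add: mem_Times_iff)
    then show "(case x of (u, v) \<Rightarrow> Z u v) \<in> span {p, q}"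
      unfolding case_prod_beta by (rule in_span)
  qed
  have orth: "orthogonal p q"
    by (simp add: p_def q_def orthogonal_def inner_vec_def sum_4)
  have "p $ 1 = c1" "p $ 2 = c2" "q $ 3 = c1" "q $ 4 = c2"
    by (simp_all add: p_def q_def)
  then have pq: "p \<noteq> 0" "q \<noteq> 0"
    using c by (metis zero_index)+
  then have "p \<noteq> q"
    using orth orthogonal_self[of p] by blast
  have "independent {p, q}"
    using orth pq by (intro pairwise_orthogonal_independent) (auto simp: pairwise_def orthogonal_commute)
  then have "dim (span {p, q}) = 2"
    using \<open>p \<noteq> q\<close> by (simp add: dim_eq_card_independent)
  then have "aff_dim (span {p, q}) = 2"
    by (simp add: aff_dim_subspace)
  moreover have "affine (span {p, q})"
    by (simp add: subspace_imp_affine)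
  moreover have "(u0, 0) \<in> J \<times> I"
    using u0 pi_gt_zero by simp
  then have "J \<times> I \<noteq> {}"
    by blast
  moreover have "openin (top_of_set (J \<times> I)) (J \<times> I)"
    by (simp only: openin_subtopology_refl) simp
  ultimately show ?thesis
    unfolding contains_open_part_of_plane_def using sub by blast
qed

text \<open>
  In the direction \<open>v\<close> the normal derivative of \<open>H\<close> is \<open>\<kappa> \<eta>\<close> times a unit vector, so for \<open>\<phi> \<noteq> 0\<close> a
  parallel \<open>H\<close> is zero. By the two preceding lemmas, the surface is then planar.
\<close>

lemma \<phi>_constant_not_parallel:
  assumes \<phi>: "\<And>u. u \<in> J \<Longrightarrow> \<phi> u = C" "C \<noteq> 0"
    and plane: "\<not> contains_open_part_of_plane J I Z"
  shows "\<not> parallel_normal_field J I Z (mean_curvature_vector J I Z)"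
proof
  assume par: "parallel_normal_field J I Z (mean_curvature_vector J I Z)"
  have \<eta>0: "L u * D u = E u * T u" if "u \<in> J" for u
  proof -
    have "\<eta> u = 0" using parallel_imp[OF par that] \<phi> that by simp
    then show ?thesis
      using E_pos[OF that] L_pos[OF that] by (simp add: \<eta>_eq)
  qed
  have "W u = 0" if "u \<in> J" for u
    using minimal_flat_imp_W_0[OF \<phi>_constant_imp[OF \<phi>(1)] \<eta>0 that] .
  from plane_if_W_0_minimal[OF this \<eta>0] plane show False by simp
qed

lemma flat_nonparallel_iff:
  assumes "\<not> contains_open_part_of_plane J I Z"
  shows "flat_normal_connection J I Z \<and> \<not> parallel_normal_field J I Z (mean_curvature_vector J I Z)
    \<longleftrightarrow> (\<exists>C. C \<noteq> 0 \<and> (\<forall>u\<in>J. \<phi> u = C))"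
proof
  assume L: "flat_normal_connection J I Z \<and> \<not> parallel_normal_field J I Z (mean_curvature_vector J I Z)"
  then obtain C where C: "\<forall>u\<in>J. \<phi> u = C"
    using flat_iff_\<phi>_constant by blast
  have "C \<noteq> 0"
  proof
    assume "C = 0"
    then have "M u = 0" if "u \<in> J" for u
      using C that E_pos[OF that] L_pos[OF that] by (auto simp: \<phi>_def)
    then show False using L parallel_if_M_0 by blast
  qed
  then show "\<exists>C. C \<noteq> 0 \<and> (\<forall>u\<in>J. \<phi> u = C)" using C by blast
next
  assume "\<exists>C. C \<noteq> 0 \<and> (\<forall>u\<in>J. \<phi> u = C)"
  then obtain C where C: "C \<noteq> 0" "\<And>u. u \<in> J \<Longrightarrow> \<phi> u = C" by blast
  then show "flat_normal_connection J I Z \<and> \<not> parallel_normal_field J I Z (mean_curvature_vector J I Z)"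
    using flat_iff_\<phi>_constant \<phi>_constant_not_parallel[OF C(2,1) assms] by blast
qed

section \<open>Meridians through the origin\<close>

lemma line_velocity:
  assumes "\<And>u. u \<in> J \<Longrightarrow> f u = c * g u" "u \<in> J"
  shows "f1 u = c * g1 u" "g u \<noteq> 0" "g1 u \<noteq> 0"
proof -
  have "((\<lambda>u. c * g u) has_vector_derivative c * g1 u) (at u within J)"
    by (rule bounded_linear.has_vector_derivative[OF bounded_linear_mult_right g_deriv[OF assms(2)]])
  from has_vector_derivative_eq_on[OF this assms(2,1)]
  show f1: "f1 u = c * g1 u"
    unfolding has_real_derivative_iff_has_vector_derivative[symmetric]
    by (rule deriv_unique[OF assms(2) real_derivs(1)[OF assms(2)]])
  show "g u \<noteq> 0"
    using L_pos[OF assms(2)] assms(1)[OF assms(2)] by (auto simp: L_def)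
  show "g1 u \<noteq> 0"
    using E_pos[OF assms(2)] f1 by (auto simp: E_def)
qed

text \<open>
  Case (i) is contained in case (ii): for \<open>W = 0\<close> the Ricci equation makes \<open>\<phi>\<close> constant, and
  on a line through the origin the velocity is nowhere orthogonal to the position vector.
\<close>

lemma line_imp_\<phi>_constant:
  assumes line: "\<And>u. u \<in> J \<Longrightarrow> f u = c * g u"
  shows "\<exists>C. C \<noteq> 0 \<and> (\<forall>u\<in>J. \<phi> u = C)"
proof -
  have "W u = 0" if "u \<in> J" for u
    by (simp add: W_def line[OF that] line_velocity[OF line that])
  then obtain C where C: "\<And>u. u \<in> J \<Longrightarrow> \<phi> u = C"
    using \<phi>_constant_if_W_0 by blast
  obtain u where u: "u \<in> J"
    using J interior_subset unfolding proper_interval_def by blast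
  have "M u = (c\<^sup>2 + 1) * (g u * g1 u)"
    by (simp add: M_def line[OF u] line_velocity(1)[OF line u] algebra_simps power2_eq_square)
  moreover have "c\<^sup>2 + 1 \<noteq> 0"
    by (metis add_nonneg_pos less_irrefl zero_le_power2 zero_less_one)
  ultimately have "M u \<noteq> 0"
    using line_velocity[OF line u] by simp
  then have "\<phi> u \<noteq> 0"
    using E_pos[OF u] L_pos[OF u] by (simp add: \<phi>_def)
  then show ?thesis
    using C u by blast
qed

text \<open>
  The surface is a cone: its rulings are the rays \<open>s \<mapsto> s *\<^sub>R e v\<close> with \<open>e v = (c cosh \<alpha>v, cosh \<beta>v,
  c sinh \<alpha>v, sinh \<beta>v)\<close>, and the tangent plane along such a ray is spanned by \<open>e v\<close> and \<open>e' v\<close>.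
\<close>

lemma line_imp_developable:
  assumes line: "\<And>u. u \<in> J \<Longrightarrow> f u = c * g u"
  shows "developable_ruled_surface J I Z"
proof -
  have "Ck_on k J I (\<lambda>u v. g u *\<^sub>R (1 :: real))" "Ck_on k J I (\<lambda>u v. (1 :: real) *\<^sub>R v)" for k
    by (intro Ck_on_separated J I Ck_g Ck_const Ck_ident)+
  then have smooth: "Ck_on k J I (\<lambda>u v. g u)" "Ck_on k J I (\<lambda>u v. v)" for k
    by simp_all
  have "inj_on g J"
  proof (rule inj_onI, rule ccontr)
    fix x y assume xy: "x \<in> J" "y \<in> J" "g x = g y" "x \<noteq> y"
    have "is_interval J" using J by (simp add: proper_interval_def)
    then obtain \<xi> where "\<xi> \<in> J" "g y - g x = (y - x) * g1 \<xi>"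
      using mvt_in_interval[OF _ xy(1,2) g_deriv] by blast
    then show False
      using xy line_velocity(3)[OF line] by simp
  qed
  then have inj: "inj_on (\<lambda>(u, v). (g u, v)) (J \<times> I)"
    by (auto simp: inj_on_def)
  have jac: "Du J (\<lambda>u v. g u) u v * Dv I (\<lambda>u v. v) u v - Dv I (\<lambda>u v. g u) u v * Du J (\<lambda>u v. v) u v \<noteq> 0"
    if uv: "u \<in> J" "v \<in> I" for u v
  proof -
    have "Du J (\<lambda>u v. g u) u v = g1 u"
      by (rule Du_eqI[OF J has_Du_fun_u[OF g_deriv] uv refl])
    moreover have "Dv I (\<lambda>u v. g u) u v = 0"
      by (rule Dv_eqI[OF I has_Dv_fun_u uv refl])
    moreover have "has_Dv J I (\<lambda>u v. v) (\<lambda>u v. 1)"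
      by (simp add: has_Dv_def has_vector_derivative_id)
    then have "Dv I (\<lambda>u v. v) u v = 1"
      by (rule Dv_eqI[OF I _ uv refl])
    ultimately show ?thesis
      using line_velocity(3)[OF line uv(1)] by simp
  qed
  have Z: "Z u v = 0 + g u *\<^sub>R rv c 1 0 0 v" if "u \<in> J" for u v
    by (simp add: rot_surf_hyp_eq_rot_vec rot_vec_scaleR line[OF that] mult.commute)
  have "rv c 1 0 0 v \<noteq> 0" for v
  proof
    assume "rv c 1 0 0 v = 0"
    then have "ip42 (rv c 1 0 0 v) (rv 0 1 0 0 v) = 0" by (simp add: ip42_def)
    then show False by (simp add: ip42_rot_vec)
  qed
  then have e0: "\<forall>v\<in>I. rv c 1 0 0 v \<noteq> 0"
    by blast
  have smooth_e: "smooth_on I (rv c 1 0 0)" "smooth_on I (\<lambda>_. 0 :: real^4)"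
    by (simp_all add: smooth_on_iff_Ck[OF I] Ck_rot_vec Ck_const)
  have I': "is_interval I" using I by (simp add: proper_interval_def)
  have Z': "\<forall>u\<in>J. \<forall>v\<in>I. v \<in> I \<and> Z u v = 0 + g u *\<^sub>R rv c 1 0 0 v"
    by (intro ballI conjI Z)
  have jac': "\<forall>u\<in>J. \<forall>v\<in>I. Du J (\<lambda>u v. g u) u v * Dv I (\<lambda>u v. v) u v
      - Dv I (\<lambda>u v. g u) u v * Du J (\<lambda>u v. v) u v \<noteq> 0"
    by (intro ballI jac)
  have "ruling_parameters J I Z (\<lambda>u v. g u) (\<lambda>u v. v)"
    unfolding ruling_parameters_def
    by (intro conjI allI exI[of _ I] exI[of _ "\<lambda>_. 0"] exI[of _ "rv c 1 0 0"] smooth inj jac' Z' I' smooth_e e0)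
  have normal: "normal_space J I Z u v = {n. ip42 (rv c 1 0 0 v) n = 0 \<and> ip42 (rv 0 0 (\<alpha> * c) \<beta> v) n = 0}"
    if uv: "u \<in> J" "v \<in> I" for u v
  proof -
    have "Du J Z u v = g1 u *\<^sub>R rv c 1 0 0 v" "Dv I Z u v = g u *\<^sub>R rv 0 0 (\<alpha> * c) \<beta> v"
      unfolding Z_u[OF uv] Z_v[OF uv]
      by (simp_all add: rot_vec_scaleR line[OF uv(1)] line_velocity(1)[OF line uv(1)] mult_ac)
    then show ?thesis
      using line_velocity(2,3)[OF line uv(1)]
      by (auto simp: normal_space_iff[OF uv] ip42_scaleR_left)
  qed
  have "\<forall>u\<in>J. \<forall>v\<in>I. \<forall>u'\<in>J. \<forall>v'\<in>I. v = v' \<longrightarrow> normal_space J I Z u v = normal_space J I Z u' v'"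
    by (intro ballI impI) (simp only: normal)
  with \<open>ruling_parameters J I Z (\<lambda>u v. g u) (\<lambda>u v. v)\<close> show ?thesis
    unfolding developable_ruled_surface_def
    by (intro exI[of _ "\<lambda>u v. g u"] exI[of _ "\<lambda>u v. v"] conjI)
qed

end

section \<open>Flat normal connection and non-parallel mean curvature\<close>

theorem theorem7p2:
  fixes \<alpha> \<beta> :: real and f g :: "real \<Rightarrow> real" and J :: "real set"
  assumes "\<alpha> > 0" and "\<beta> > 0"
    and "is_interval J" and "interior J \<noteq> {}"
    and "smooth_on J f" and "smooth_on J g"
    and "\<forall>u\<in>J. \<alpha>\<^sup>2 * (f u)\<^sup>2 + \<beta>\<^sup>2 * (g u)\<^sup>2 > 0"
    and "\<forall>u\<in>J. (deriv_in J f u)\<^sup>2 + (deriv_in J g u)\<^sup>2 > 0"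
    and "\<not> contains_open_part_of_plane J {0..<2*pi} (rot_surf_hyp \<alpha> \<beta> f g)"
  shows "(flat_normal_connection J {0..<2*pi} (rot_surf_hyp \<alpha> \<beta> f g) \<and>
          \<not> parallel_normal_field J {0..<2*pi} (rot_surf_hyp \<alpha> \<beta> f g)
              (mean_curvature_vector J {0..<2*pi} (rot_surf_hyp \<alpha> \<beta> f g))
          \<longleftrightarrow>
          (\<exists>c. c \<noteq> 0 \<and> \<alpha> \<noteq> \<beta> \<and> (\<forall>u\<in>J. f u = c * g u)) \<or>
          (\<exists>C. C \<noteq> 0 \<and> (\<forall>u\<in>J.
             (f u * deriv_in J f u + g u * deriv_in J g u) /
               (sqrt ((deriv_in J f u)\<^sup>2 + (deriv_in J g u)\<^sup>2) *
                sqrt (\<alpha>\<^sup>2 * (f u)\<^sup>2 + \<beta>\<^sup>2 * (g u)\<^sup>2)) = C)))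
       \<and> ((\<exists>c. c \<noteq> 0 \<and> \<alpha> \<noteq> \<beta> \<and> (\<forall>u\<in>J. f u = c * g u)) \<longrightarrow>
          developable_ruled_surface J {0..<2*pi} (rot_surf_hyp \<alpha> \<beta> f g))"
proof -
  interpret hyperbolic_rotational_surface \<alpha> \<beta> f g J
    using assms by unfold_locales (simp_all add: proper_interval_def)
  have \<phi>: "(f u * deriv_in J f u + g u * deriv_in J g u) /
               (sqrt ((deriv_in J f u)\<^sup>2 + (deriv_in J g u)\<^sup>2) *
                sqrt (\<alpha>\<^sup>2 * (f u)\<^sup>2 + \<beta>\<^sup>2 * (g u)\<^sup>2)) = \<phi> u" for u
    by (simp add: \<phi>_def M_def E_def L_def f1_def g1_def)
  show ?thesis
    unfolding \<phi> flat_nonparallel_iff[OF assms(9)]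
    using line_imp_\<phi>_constant line_imp_developable by blast
qed

end
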